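(* Let $k\ge 1$, $n>k+2$ and $r>2$ be integers, let $M=n(r-1)+1$ and $N=(k-1)(r-1)+2(r-2)+1$, and let $j$ be a nonnegative integer with $j<\lfloor M/N\rfloor (N-1)+{}_NR_M$, where ${}_NR_M$ is the remainder of $N$ on division by $M$. Then $$\begin{aligned}C^{nb}_k(r,n,j)={}&\sum_{i=0}^{r-3}\binom{r-2}{i}F_k(r,n-1,j-i)+\sum_{i=0}^{2r-4}\binom{2r-4}{i}F_k(r,n-3,j-i-(r-2))\\&+2\sum_{l=1}^{k-1}\sum_{i=0}^{r-2}\binom{r-2}{i}F_k^l(r,n-2,j-(r-2)-i)\\&+2\sum_{b=0}^{r-3}\sum_{a=0}^{r-2}\binom{r-2}{a}\binom{r-2}{b}F_k(r,n-3,j-(r-2)-1-(a+b))\\&+2\sum_{i=0}^{2r-4}\binom{2r-4}{i}F_k(r,n-4,j-2(r-2)-1-i).\end{aligned}$$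
   Context: An $r$-uniform hypergraph has a vertex set and an edge set, each edge being an $r$-element set of vertices. A loose $r$-path of length $n$ is an $r$-uniform hypergraph (without isolated vertices) with $n$ edges that can be ordered $E_1,\dots,E_n$ so that $|E_i\cap E_j|=1$ if $|i-j|=1$ and $E_i\cap E_j=\emptyset$ if $|i-j|\ge 2$; it has $n(r-1)+1$ vertices. A loose $r$-path of length $0$ is a single vertex. A loose $r$-cycle of length $n$ is an $r$-uniform hypergraph with $n$ edges in which every edge has exactly two vertices of degree $2$ and all its other vertices of degree $1$, and such that removing any single edge together with its degree-1 vertices leaves a loose $r$-path of length $n-1$; its edges are labeled cyclically $E_1,\dots,E_n$ (cyclically consecutive edges meet in one vertex), and it has $n(r-1)$ vertices. Vertices are colored red or blue; an edge is blue if all its vertices are blue; a blue subpath of length $k$ means $k$ consecutive (cyclically consecutive, for cycles) edges all of which are blue. All counts are of red/blue colorings of labeled vertices with exactly $j$ blue vertices, and are $0$ if $j<0$. $F_k(r,n,j)$: number of such colorings of a loose $r$-path with $n$ edges having no blue subpath of length $k$. $F_k^l(r,n,j)$: number of those colorings counted by $F_k(r,n,j)$ in which the first $l$ edges $E_1,\dots,E_l$ are blue and $E_{l+1}$ is not blue. $C_k^{nb}(r,n,j)$: number of such colorings of a loose $r$-cycle with $n$ edges having no blue subpath of length $k$ and in which the edge $E_n$ is not blue. *)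

theory Defs
  imports Main
begin

section \<open>Loose paths and loose cycles\<close>

definition uniform_hypergraph :: "nat \<Rightarrow> 'a set \<Rightarrow> 'a set set \<Rightarrow> bool" where
  "uniform_hypergraph r V \<E> \<longleftrightarrow> finite V \<and> (\<forall>e\<in>\<E>. e \<subseteq> V \<and> card e = r)"

definition degree :: "'a set set \<Rightarrow> 'a \<Rightarrow> nat" where
  "degree \<E> v = card {e \<in> \<E>. v \<in> e}"

text \<open>Labelled edges are given by a function on \<open>nat\<close> of which only the values at
  \<open>1, \<dots>, n\<close> matter. A path of length \<open>0\<close> is a single vertex, which is the one
  exception to the absence of isolated vertices.\<close>

definition loose_path_labelling :: "nat \<Rightarrow> nat \<Rightarrow> 'a set \<Rightarrow> (nat \<Rightarrow> 'a set) \<Rightarrow> bool" where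
  "loose_path_labelling r n V E \<longleftrightarrow>
     uniform_hypergraph r V (E ` {1..n}) \<and> inj_on E {1..n} \<and>
     (if n = 0 then card V = 1 else V = \<Union> (E ` {1..n})) \<and>
     (\<forall>i\<in>{1..n}. \<forall>j\<in>{1..n}.
        (\<bar>int i - int j\<bar> = 1 \<longrightarrow> card (E i \<inter> E j) = 1) \<and>
        (\<bar>int i - int j\<bar> \<ge> 2 \<longrightarrow> E i \<inter> E j = {}))"

definition loose_path :: "nat \<Rightarrow> nat \<Rightarrow> 'a set \<Rightarrow> 'a set set \<Rightarrow> bool" where
  "loose_path r n V \<E> \<longleftrightarrow> (\<exists>E. \<E> = E ` {1..n} \<and> loose_path_labelling r n V E)"

definition loose_cycle :: "nat \<Rightarrow> nat \<Rightarrow> 'a set \<Rightarrow> 'a set set \<Rightarrow> bool" where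
  "loose_cycle r n V \<E> \<longleftrightarrow>
     uniform_hypergraph r V \<E> \<and> card \<E> = n \<and> V = \<Union> \<E> \<and>
     (\<forall>e\<in>\<E>. card {v \<in> e. degree \<E> v = 2} = 2 \<and> (\<forall>v\<in>e. degree \<E> v = 1 \<or> degree \<E> v = 2)) \<and>
     (\<forall>e\<in>\<E>. loose_path r (n - 1) (V - {v \<in> e. degree \<E> v = 1}) (\<E> - {e}))"

text \<open>The edge following \<open>E i\<close> cyclically is \<open>E (i mod n + 1)\<close>; in particular \<open>E 1\<close> follows \<open>E n\<close>.\<close>

definition loose_cycle_labelling :: "nat \<Rightarrow> nat \<Rightarrow> 'a set \<Rightarrow> (nat \<Rightarrow> 'a set) \<Rightarrow> bool" where
  "loose_cycle_labelling r n V E \<longleftrightarrow>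
     loose_cycle r n V (E ` {1..n}) \<and> inj_on E {1..n} \<and>
     (\<forall>i\<in>{1..n}. card (E i \<inter> E (i mod n + 1)) = 1)"

section \<open>Counting colorings\<close>

text \<open>A red/blue coloring of \<open>V\<close> is represented by its set \<open>B\<close> of blue vertices, so that an edge
  \<open>e\<close> is blue iff \<open>e \<subseteq> B\<close>. The number \<open>j\<close> of blue vertices is an integer; the
  counts vanish for \<open>j < 0\<close>.\<close>

definition colorings :: "'a set \<Rightarrow> int \<Rightarrow> 'a set set" where
  "colorings V j = {B. B \<subseteq> V \<and> int (card B) = j}"

definition blue :: "'a set \<Rightarrow> 'a set \<Rightarrow> bool" where
  "blue B e \<longleftrightarrow> e \<subseteq> B"

definition path_blue_subpath :: "nat \<Rightarrow> nat \<Rightarrow> (nat \<Rightarrow> 'a set) \<Rightarrow> 'a set \<Rightarrow> bool" where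
  "path_blue_subpath k n E B \<longleftrightarrow> (\<exists>s. s + k \<le> n \<and> (\<forall>t\<in>{1..k}. blue B (E (s + t))))"

definition cycle_blue_subpath :: "nat \<Rightarrow> nat \<Rightarrow> (nat \<Rightarrow> 'a set) \<Rightarrow> 'a set \<Rightarrow> bool" where
  "cycle_blue_subpath k n E B \<longleftrightarrow>
     k \<le> n \<and> (\<exists>s. \<forall>t\<in>{0..<k}. blue B (E ((s + t) mod n + 1)))"

text \<open>\<open>F_count k n V E j\<close>, \<open>F_init_count k l n V E j\<close> and \<open>C_nb_count k n V E j\<close> are
  $F_k(r,n,j)$, $F_k^l(r,n,j)$ and $C_k^{nb}(r,n,j)$, computed on the labelled loose \<open>r\<close>-path, or
  loose \<open>r\<close>-cycle, with vertex set \<open>V\<close> and edges \<open>E 1, \<dots>, E n\<close>.\<close>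

definition F_count :: "nat \<Rightarrow> nat \<Rightarrow> 'a set \<Rightarrow> (nat \<Rightarrow> 'a set) \<Rightarrow> int \<Rightarrow> nat" where
  "F_count k n V E j = card {B \<in> colorings V j. \<not> path_blue_subpath k n E B}"

definition F_init_count :: "nat \<Rightarrow> nat \<Rightarrow> nat \<Rightarrow> 'a set \<Rightarrow> (nat \<Rightarrow> 'a set) \<Rightarrow> int \<Rightarrow> nat" where
  "F_init_count k l n V E j =
     card {B \<in> colorings V j. \<not> path_blue_subpath k n E B \<and>
       l < n \<and> (\<forall>i\<in>{1..l}. blue B (E i)) \<and> \<not> blue B (E (l + 1))}"

definition C_nb_count :: "nat \<Rightarrow> nat \<Rightarrow> 'a set \<Rightarrow> (nat \<Rightarrow> 'a set) \<Rightarrow> int \<Rightarrow> nat" where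
  "C_nb_count k n V E j =
     card {B \<in> colorings V j. \<not> cycle_blue_subpath k n E B \<and> \<not> blue B (E n)}"

section \<open>Existence of loose paths and loose cycles\<close>

text \<open>Concrete models on vertices \<open>(i, a)\<close>, where \<open>(i, 0), \<dots>, (i, r - 2)\<close> lie in the \<open>i\<close>-th
  edge and \<open>(i, 0)\<close> is shared with the preceding one. They show that the predicates above are
  satisfiable.\<close>

definition std_path_edge :: "nat \<Rightarrow> nat \<Rightarrow> (nat \<times> nat) set" where
  "std_path_edge r i = insert (Suc i, 0) ({i} \<times> {0..<r - 1})"

definition std_cycle_edge :: "nat \<Rightarrow> nat \<Rightarrow> nat \<Rightarrow> (nat \<times> nat) set" where
  "std_cycle_edge r n i = insert (i mod n + 1, 0) ({i} \<times> {0..<r - 1})"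

lemma std_path_exists:
  assumes "r > 2"
  shows "\<exists>V. loose_path_labelling r n V (std_path_edge r)"
proof (cases "n = 0")
  case True
  then show ?thesis
    by (intro exI[of _ "{(0,0)}"]) (simp add: loose_path_labelling_def uniform_hypergraph_def)
next
  case False
  have c: "card (std_path_edge r i) = r" for i
    using assms unfolding std_path_edge_def by (subst card_insert_disjoint) auto
  have m1: "std_path_edge r i \<inter> std_path_edge r (Suc i) = {(Suc i, 0)}" for i
    using assms by (auto simp: std_path_edge_def)
  have m2: "std_path_edge r i \<inter> std_path_edge r j = {}" if "\<bar>int i - int j\<bar> \<ge> 2" for i j
  proof -
    have "i \<noteq> j" "i \<noteq> Suc j" "j \<noteq> Suc i" using that by auto
    then show ?thesis by (auto simp: std_path_edge_def)
  qed
  have m3: "card (std_path_edge r i \<inter> std_path_edge r j) = 1" if "\<bar>int i - int j\<bar> = 1" for i j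
  proof -
    have "j = Suc i \<or> i = Suc j" using that by linarith
    then show ?thesis using m1[of i] m1[of j] by (metis Int_commute is_singletonI is_singleton_altdef)
  qed
  have inj: "inj_on (std_path_edge r) {1..n}"
  proof (rule inj_onI)
    fix i j assume e: "std_path_edge r i = std_path_edge r j"
    have "(i, 1) \<in> std_path_edge r i" using assms by (simp add: std_path_edge_def)
    then have "(i, 1) \<in> std_path_edge r j" unfolding e .
    then show "i = j" by (simp add: std_path_edge_def)
  qed
  have "finite (\<Union> (std_path_edge r ` {1..n}))"
    by (simp add: std_path_edge_def)
  then have "uniform_hypergraph r (\<Union> (std_path_edge r ` {1..n})) (std_path_edge r ` {1..n})"
    unfolding uniform_hypergraph_def using c by blast
  then have "loose_path_labelling r n (\<Union> (std_path_edge r ` {1..n})) (std_path_edge r)"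
    unfolding loose_path_labelling_def using inj False m2 m3 by simp
  then show ?thesis by blast
qed

lemma std_cycle_exists:
  assumes r: "r > 2" and n: "n \<ge> 3"
  shows "\<exists>V. loose_cycle_labelling r n V (std_cycle_edge r n)"
proof -
  define E where "E = std_cycle_edge r n"
  define V where "V = \<Union> (E ` {1..n})"
  define \<E> where "\<E> = E ` {1..n}"
  define nx where "nx i = (if i = n then 1 else Suc i)" for i
  define pr where "pr i = (if i = 1 then n else i - 1)" for i
  have nx: "i mod n + 1 = nx i" if "i \<in> {1..n}" for i
    using that n by (auto simp: nx_def)
  have E: "p \<in> E i \<longleftrightarrow> fst p = i \<and> snd p < r - 1 \<or> p = (nx i, 0)" if "i \<in> {1..n}" for i p
    unfolding E_def std_cycle_edge_def nx[OF that] by (cases p) auto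
  have nx1: "nx i \<noteq> i" "nx i \<in> {1..n}" "pr (nx i) = i" "nx (nx i) \<noteq> i" "pr i \<in> {1..n}"
    "nx (pr i) = i" "pr i \<noteq> i" if "i \<in> {1..n}" for i
    using that n by (auto simp: nx_def pr_def split: if_splits)
  have nxinj: "i = j" if "nx i = nx j" "i \<in> {1..n}" "j \<in> {1..n}" for i j
    using that nx1(3) by metis
  have c: "card (E i) = r" "finite (E i)" if "i \<in> {1..n}" for i
  proof -
    have *: "E i = insert (nx i, 0) ({i} \<times> {0..<r - 1})"
      unfolding E_def std_cycle_edge_def nx[OF that] ..
    show "card (E i) = r" unfolding * using nx1(1)[OF that] r
      by (subst card_insert_disjoint) auto
    show "finite (E i)" unfolding * by simp
  qed
  have inj: "inj_on E {1..n}"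
  proof (rule inj_onI)
    fix i j assume i: "i \<in> {1..n}" and j: "j \<in> {1..n}" and e: "E i = E j"
    have "(i, 1) \<in> E i" using E[OF i] r by simp
    then have "(i, 1) \<in> E j" unfolding e .
    then show "i = j" using E[OF j] by simp
  qed
  have meet: "E i \<inter> E (nx i) = {(nx i, 0)}" if i: "i \<in> {1..n}" for i
  proof (rule set_eqI)
    fix p
    show "p \<in> E i \<inter> E (nx i) \<longleftrightarrow> p \<in> {(nx i, 0)}"
      using E[OF i, of p] E[OF nx1(2)[OF i], of p] nx1(1)[OF i] nx1(4)[OF i]
        nx1(1)[OF nx1(2)[OF i]] r by (cases p) auto
  qed
  have disj: "E i \<inter> E j = {}"
    if i: "i \<in> {1..n}" and j: "j \<in> {1..n}" and ij: "i \<noteq> j" "j \<noteq> nx i" "i \<noteq> nx j" for i j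
  proof -
    have "p \<notin> E i \<or> p \<notin> E j" for p
      using E[OF i, of p] E[OF j, of p] ij nxinj[OF _ i j] by (cases p) auto
    then show ?thesis by blast
  qed
  have unif: "uniform_hypergraph r V \<E>"
    unfolding uniform_hypergraph_def V_def \<E>_def using c by blast
  have deg2: "degree \<E> (i, 0) = 2" if i: "i \<in> {1..n}" for i
  proof -
    have "{e \<in> \<E>. (i, 0) \<in> e} = {E i, E (pr i)}"
    proof (intro set_eqI iffI)
      fix e assume "e \<in> {e \<in> \<E>. (i, 0) \<in> e}"
      then obtain j where j: "j \<in> {1..n}" "e = E j" "(i, 0) \<in> E j" unfolding \<E>_def by blast
      then have "i = j \<or> i = nx j" using E[OF j(1), of "(i, 0)"] by auto
      then show "e \<in> {E i, E (pr i)}" using j(2) nx1(3)[OF j(1)] by auto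
    next
      fix e assume "e \<in> {E i, E (pr i)}"
      then show "e \<in> {e \<in> \<E>. (i, 0) \<in> e}"
        unfolding \<E>_def using E[OF i] E[OF nx1(5)[OF i]] i nx1(5)[OF i] nx1(6)[OF i] r by auto
    qed
    moreover have "E i \<noteq> E (pr i)"
      using inj i nx1(5)[OF i] nx1(7)[OF i] unfolding inj_on_def by metis
    ultimately show ?thesis unfolding degree_def by simp
  qed
  have deg1: "degree \<E> (i, a) = 1" if i: "i \<in> {1..n}" and a: "0 < a" "a < r - 1" for i a
  proof -
    have "{e \<in> \<E>. (i, a) \<in> e} = {E i}"
      unfolding \<E>_def using E i a by auto
    then show ?thesis unfolding degree_def by simp
  qed
  have d: "{v \<in> E i. degree \<E> v = 2} = {(i, 0), (nx i, 0)}"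
    "{v \<in> E i. degree \<E> v = 1} = {i} \<times> {1..<r - 1}"
    "\<forall>v\<in>E i. degree \<E> v = 1 \<or> degree \<E> v = 2" if i: "i \<in> {1..n}" for i
  proof -
    have *: "v \<in> E i \<longleftrightarrow> v \<in> {(i, 0), (nx i, 0)} \<union> {i} \<times> {1..<r - 1}" for v
      using E[OF i, of v] r by (cases v) (auto simp: Suc_le_eq)
    have d2: "degree \<E> v = 2" if "v \<in> {(i, 0), (nx i, 0)}" for v
      using that deg2[OF i] deg2[OF nx1(2)[OF i]] by auto
    have d1: "degree \<E> v = 1" if "v \<in> {i} \<times> {1..<r - 1}" for v
      using that deg1[OF i] by auto
    have d2': "degree \<E> v \<noteq> 1" if "v \<in> {(i, 0), (nx i, 0)}" for v
      using d2[OF that] by simp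
    have d1': "degree \<E> v \<noteq> 2" if "v \<in> {i} \<times> {1..<r - 1}" for v
      using d1[OF that] by simp
    show "{v \<in> E i. degree \<E> v = 2} = {(i, 0), (nx i, 0)}"
      using * d1' d2 by blast
    show "{v \<in> E i. degree \<E> v = 1} = {i} \<times> {1..<r - 1}"
      using * d1 d2' by blast
    show "\<forall>v\<in>E i. degree \<E> v = 1 \<or> degree \<E> v = 2"
      using * d1 d2 by blast
  qed
  have removal: "loose_path r (n - 1) (V - {v \<in> E i. degree \<E> v = 1}) (\<E> - {E i})"
    if i: "i \<in> {1..n}" for i
  proof -
    define g where "g t = (if i + t \<le> n then i + t else i + t - n)" for t
    have g: "g ` {1..n - 1} = {1..n} - {i}"
    proof (intro set_eqI iffI)
      fix x assume "x \<in> g ` {1..n - 1}"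
      then show "x \<in> {1..n} - {i}" using i by (auto simp: g_def split: if_splits)
    next
      fix x assume x: "x \<in> {1..n} - {i}"
      show "x \<in> g ` {1..n - 1}"
      proof (rule image_eqI)
        show "x = g (if x > i then x - i else x + n - i)" using x i by (auto simp: g_def)
        show "(if x > i then x - i else x + n - i) \<in> {1..n - 1}" using x i by auto
      qed
    qed
    have gi: "inj_on g {1..n - 1}"
      by (rule inj_onI) (auto simp: g_def split: if_splits)
    have gr: "g t \<in> {1..n}" "g t \<noteq> i" if "t \<in> {1..n - 1}" for t
      using g that by blast+
    have gn: "nx (g t) = g (Suc t)" if "t \<in> {1..n - 1}" for t
      using that i by (auto simp: nx_def g_def)
    have gnx: "nx (g t) = g u \<longleftrightarrow> u = Suc t" if "t \<in> {1..n - 1}" "u \<in> {1..n - 1}" for t u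
    proof (cases "Suc t \<in> {1..n - 1}")
      case True
      then show ?thesis using gn[OF that(1)] gi that by (metis inj_onD)
    next
      case False
      then have "t = n - 1" using that by auto
      then have "g (Suc t) = i" using i n by (simp add: g_def)
      then show ?thesis using gn[OF that(1)] gr[OF that(2)] False that by metis
    qed
    let ?D = "\<lambda>t. E (g t)"
    let ?W = "V - {v \<in> E i. degree \<E> v = 1}"
    have im: "?D ` {1..n - 1} = E ` ({1..n} - {i})"
      unfolding g[symmetric] image_image ..
    have Ed: "\<E> - {E i} = ?D ` {1..n - 1}"
      unfolding im \<E>_def using inj_on_image_set_diff[OF inj, of "{1..n}" "{i}"] i by simp
    have W: "?W = \<Union> (?D ` {1..n - 1})"
    proof (intro set_eqI iffI)
      fix p assume p: "p \<in> ?W"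
      then obtain j where j: "j \<in> {1..n}" "p \<in> E j" unfolding V_def by blast
      show "p \<in> \<Union> (?D ` {1..n - 1})"
      proof (cases "j = i")
        case False
        then show ?thesis unfolding im using j by blast
      next
        case True
        then have "degree \<E> p = 2" using p j d(3)[OF i] by blast
        then have "p = (i, 0) \<or> p = (nx i, 0)" using d(1)[OF i] j True by blast
        then have "p \<in> E (pr i) \<or> p \<in> E (nx i)"
          using E[OF nx1(5)[OF i]] E[OF nx1(2)[OF i]] nx1(6)[OF i] r by auto
        then show ?thesis unfolding im using nx1[OF i] by blast
      qed
    next
      fix p assume "p \<in> \<Union> (?D ` {1..n - 1})"
      then obtain j where j: "j \<in> {1..n}" "j \<noteq> i" "p \<in> E j" unfolding im by blast
      then have "p \<notin> {i} \<times> {1..<r - 1}" using E[OF j(1)] by auto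
      then show "p \<in> ?W" unfolding d(2)[OF i] V_def using j by blast
    qed
    have u: "uniform_hypergraph r ?W (?D ` {1..n - 1})"
      using unif c gr(1) unfolding uniform_hypergraph_def W by blast
    have "inj_on ?D {1..n - 1}"
      using comp_inj_on[OF gi, of E] inj g by (simp add: comp_def inj_on_diff)
    moreover have "card (?D t \<inter> ?D s) = 1"
      if "t \<in> {1..n - 1}" "s \<in> {1..n - 1}" "\<bar>int t - int s\<bar> = 1" for t s
    proof -
      have "s = Suc t \<or> t = Suc s" using that by linarith
      then have "g s = nx (g t) \<or> g t = nx (g s)" using gn that by metis
      then show ?thesis using meet gr that
        by (metis Int_commute is_singletonI is_singleton_altdef)
    qed
    moreover have "?D t \<inter> ?D s = {}"
      if "t \<in> {1..n - 1}" "s \<in> {1..n - 1}" "\<bar>int t - int s\<bar> \<ge> 2" for t s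
    proof -
      have ne: "s \<noteq> t" "s \<noteq> Suc t" "t \<noteq> Suc s" using that by auto
      then have "g t \<noteq> g s" using gi that by (metis inj_onD)
      moreover have "g s \<noteq> nx (g t)" "g t \<noteq> nx (g s)" using gnx that ne by metis+
      ultimately show ?thesis using disj gr that by metis
    qed
    ultimately have "loose_path_labelling r (n - 1) ?W ?D"
      unfolding loose_path_labelling_def using u W n by simp
    then show ?thesis unfolding loose_path_def Ed by blast
  qed
  have "card \<E> = n" unfolding \<E>_def using inj by (simp add: card_image)
  moreover have "card {v \<in> E i. degree \<E> v = 2} = 2" if i: "i \<in> {1..n}" for i
    unfolding d(1)[OF i] using nx1(1)[OF i] by simp
  ultimately have "loose_cycle r n V \<E>"
    unfolding loose_cycle_def using unif d(3) removal by (auto simp: V_def \<E>_def)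
  then have "loose_cycle_labelling r n V E"
    unfolding loose_cycle_labelling_def using inj meet nx by (auto simp: \<E>_def)
  then show ?thesis unfolding E_def by blast
qed

end

theory Submission
  imports Defs
begin

text \<open>If \<open>E n\<close> is not blue, then blue subpaths of the cycle are blue subpaths of the path
  \<open>E 1, \<dots>, E (n - 1)\<close>. Let \<open>P n\<close> be the set of vertices of degree 1 of \<open>E n\<close>. Either \<open>P n\<close> is not
  completely blue, and the path is coloured independently, or one of the two end vertices of
  \<open>E n\<close> is red. A red end vertex makes the edge next to \<open>E n\<close> non-blue, so that this edge can be
  removed and its degree-1 vertices become free. If both ends are red a path of length
  \<open>n - 3\<close> remains. If only the end in \<open>E (n - 1)\<close> is red, the path \<open>E 1, \<dots>, E (n - 2)\<close>
  remains, with a blue first vertex: \<open>E 1\<close> is blue, or one of its degree-1 vertices is red,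
  or only the vertex shared with \<open>E 2\<close> is. The remaining case is the mirror image, which
  explains the factors 2.\<close>

section \<open>Isomorphism invariance of the counts\<close>

abbreviation num_colorings :: "'a set \<Rightarrow> ('a set \<Rightarrow> bool) \<Rightarrow> int \<Rightarrow> nat" where
  "num_colorings V Q j \<equiv> card {B \<in> colorings V j. Q B}"

lemma finite_colorings: "finite V \<Longrightarrow> finite {B \<in> colorings V j. Q B}"
  by (rule finite_subset[of _ "Pow V"]) (auto simp: colorings_def)

text \<open>Taking images under \<open>f\<close> is a bijection from the subsets of \<open>V\<close>
  to those of \<open>W\<close> and preserves their sizes. This moves counts between isomorphic
  paths.\<close>

lemma num_colorings_bij:
  assumes f: "bij_betw f V W" and Q: "\<And>B. B \<subseteq> V \<Longrightarrow> Q' (f ` B) = Q B"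
  shows "num_colorings V Q j = num_colorings W Q' j"
proof (rule bij_betw_same_card[of "image f"])
  have inj: "inj_on f V" and im: "f ` V = W" using f by (auto simp: bij_betw_def)
  have card: "card (f ` B) = card B" if "B \<subseteq> V" for B
    using inj that by (meson card_image inj_on_subset)
  have "image f ` {B \<in> colorings V j. Q B} = {B \<in> colorings W j. Q' B}"
  proof (intro set_eqI iffI)
    fix B assume "B \<in> {B \<in> colorings W j. Q' B}"
    then have B: "B \<subseteq> f ` V" "int (card B) = j" "Q' B" by (auto simp: colorings_def im)
    then obtain A where "A \<subseteq> V" "B = f ` A" by (auto simp: subset_image_iff)
    with B show "B \<in> image f ` {B \<in> colorings V j. Q B}"
      using Q card by (auto simp: colorings_def)
  qed (use Q card im in \<open>auto simp: colorings_def\<close>)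
  then show "bij_betw (image f) {B \<in> colorings V j. Q B} {B \<in> colorings W j. Q' B}"
    using inj_on_image_Pow[OF inj] by (auto simp: bij_betw_def colorings_def intro: inj_on_subset)
qed

text \<open>Every type occurs equally often on both sides, so bijections chosen type by type glue
  together. The type of a vertex will be the set of indices of the edges through it.\<close>

lemma bij_betw_preserving_types:
  assumes "finite V" "finite W"
    and card: "\<And>S. card {x \<in> V. t x = S} = card {y \<in> W. u y = S}"
  shows "\<exists>f. bij_betw f V W \<and> (\<forall>x\<in>V. u (f x) = t x)"
proof -
  have "\<exists>g. bij_betw g {x \<in> V. t x = S} {y \<in> W. u y = S}" for S
    using assms by (intro finite_same_card_bij) auto
  then obtain g where g: "\<And>S. bij_betw (g S) {x \<in> V. t x = S} {y \<in> W. u y = S}" by metis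
  define f where "f x = g (t x) x" for x
  have f: "f x \<in> W \<and> u (f x) = t x" if "x \<in> V" for x
    using bij_betw_apply[OF g[of "t x"]] that by (auto simp: f_def)
  have "inj_on f V"
  proof (rule inj_onI)
    fix x y assume xy: "x \<in> V" "y \<in> V" "f x = f y"
    then have "t x = t y" using f by metis
    then show "x = y"
      using bij_betw_imp_inj_on[OF g[of "t x"]] xy by (auto simp: f_def inj_on_def)
  qed
  moreover have "f ` V = W"
  proof (intro set_eqI iffI)
    fix y assume "y \<in> W"
    then have "y \<in> g (u y) ` {x \<in> V. t x = u y}"
      using bij_betw_imp_surj_on[OF g[of "u y"]] by auto
    then obtain x where "x \<in> V" "y = f x" by (auto simp: f_def)
    then show "y \<in> f ` V" by blast
  qed (use f in auto)
  ultimately show ?thesis using f by (auto simp: bij_betw_def)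
qed

text \<open>For \<open>m > 0\<close>, edges at distance two or more are disjoint, so a vertex lies
  in one edge or in two consecutive ones; an edge shares one vertex with each neighbour. What
  matters later is that the right-hand side depends only on \<open>r\<close>, \<open>m\<close> and
  \<open>S\<close>.\<close>

lemma card_loose_path_type:
  assumes "loose_path_labelling r m V E"
  shows "card {x \<in> V. {i \<in> {1..m}. x \<in> E i} = S} =
    (if m = 0 then if S = {} then 1 else 0
     else if \<exists>i\<in>{1..<m}. S = {i, Suc i} then 1
     else if \<exists>i\<in>{1..m}. S = {i} then r - (if 1 < Min S then 1 else 0) - (if Min S < m then 1 else 0)
     else 0)"
proof (cases "m = 0")
  case True
  with assms show ?thesis by (auto simp: loose_path_labelling_def)
next
  case False
  have V: "V = \<Union> (E ` {1..m})" and fV: "finite V" and c: "\<And>i. i \<in> {1..m} \<Longrightarrow> card (E i) = r"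
    and c1: "\<And>i j. i \<in> {1..m} \<Longrightarrow> j \<in> {1..m} \<Longrightarrow> \<bar>int i - int j\<bar> = 1 \<Longrightarrow> card (E i \<inter> E j) = 1"
    and far: "\<And>i j. i \<in> {1..m} \<Longrightarrow> j \<in> {1..m} \<Longrightarrow> \<bar>int i - int j\<bar> \<ge> 2 \<Longrightarrow> E i \<inter> E j = {}"
    using assms False by (auto simp: loose_path_labelling_def uniform_hypergraph_def)
  have adj: "j = i \<or> j = Suc i \<or> i = Suc j"
    if "x \<in> E i" "x \<in> E j" "i \<in> {1..m}" "j \<in> {1..m}" for x i j
  proof (rule ccontr)
    assume "\<not> ?thesis"
    then have "\<bar>int i - int j\<bar> \<ge> 2" by linarith
    then show False using far[OF that(3,4)] that by blast
  qed
  let ?T = "{x \<in> V. {i \<in> {1..m}. x \<in> E i} = S}"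
  consider (two) i where "i \<in> {1..<m}" "S = {i, Suc i}"
    | (one) i where "i \<in> {1..m}" "S = {i}"
    | (none) "\<not> (\<exists>i\<in>{1..<m}. S = {i, Suc i})" "\<not> (\<exists>i\<in>{1..m}. S = {i})"
    by blast
  then show ?thesis
  proof cases
    case two
    have "?T = E i \<inter> E (Suc i)"
    proof (intro set_eqI iffI)
      fix x assume x: "x \<in> E i \<inter> E (Suc i)"
      have "j = i \<or> j = Suc i" if "j \<in> {1..m}" "x \<in> E j" for j
        using adj[of x i j] adj[of x "Suc i" j] x that two by auto
      then show "x \<in> ?T" using x two by (auto simp: V)
    qed (use two in auto)
    then show ?thesis using two c1[of i "Suc i"] False by auto
  next
    case one
    \<comment> \<open>\<open>L\<close> and \<open>R\<close> hold the vertex shared with the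
      preceding and the following edge, and are empty at the ends of the path.\<close>
    define L where "L = (if 1 < i then E i \<inter> E (i - 1) else {})"
    define R where "R = (if i < m then E i \<inter> E (Suc i) else {})"
    have "?T = E i - L - R"
    proof (intro set_eqI iffI)
      fix x assume x: "x \<in> E i - L - R"
      have "j = i" if "j \<in> {1..m}" "x \<in> E j" for j
        using adj[of x i j] x that one by (auto simp: L_def R_def split: if_splits)
      then have "{j \<in> {1..m}. x \<in> E j} = {i}" using x one by blast
      moreover have "x \<in> V" using x one unfolding V by blast
      ultimately show "x \<in> ?T" using one by simp
    next
      fix x assume "x \<in> ?T"
      then have "{j \<in> {1..m}. x \<in> E j} = {i}" using one by simp
      then have *: "j \<in> {1..m} \<and> x \<in> E j \<longleftrightarrow> j = i" for j by blast
      have "x \<notin> L"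
      proof (cases "1 < i")
        case True
        then have "i - 1 \<in> {1..m}" using one by auto
        then show ?thesis using *[of "i - 1"] True by (auto simp: L_def)
      qed (simp add: L_def)
      moreover have "x \<notin> R" using *[of "Suc i"] by (auto simp: R_def)
      ultimately show "x \<in> E i - L - R" using *[of i] by blast
    qed
    \<comment> \<open>The two neighbours of \<open>E i\<close> are disjoint, hence so are
      \<open>L\<close> and \<open>R\<close>, and their sizes can be subtracted one after the
      other.\<close>
    moreover have "E (i - 1) \<inter> E (Suc i) = {}" if "1 < i" "i < m" using that by (intro far) auto
    then have LR: "L \<subseteq> E i" "R \<subseteq> E i - L" unfolding L_def R_def by auto
    moreover have "finite (E i)" using fV one by (auto simp: V)
    then have "finite L" "finite R" using LR by (auto intro: finite_subset)
    moreover have "card L = (if 1 < i then 1 else 0)"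
    proof (cases "1 < i")
      case True
      then have "card (E i \<inter> E (i - 1)) = 1" using one by (intro c1) auto
      then show ?thesis using True by (simp add: L_def)
    qed (simp add: L_def)
    moreover have "card R = (if i < m then 1 else 0)"
    proof (cases "i < m")
      case True
      then have "card (E i \<inter> E (Suc i)) = 1" using one by (intro c1) auto
      then show ?thesis using True by (simp add: R_def)
    qed (simp add: R_def)
    ultimately have "card ?T = r - (if 1 < i then 1 else 0) - (if i < m then 1 else 0)"
      using c[OF one(1)] by (simp add: card_Diff_subset)
    then show ?thesis using one False by auto
  next
    case none
    have "?T = {}"
    proof (rule ccontr)
      assume "?T \<noteq> {}"
      then obtain x i where x: "{i \<in> {1..m}. x \<in> E i} = S" "i \<in> {1..m}" "x \<in> E i" by (auto simp: V)
      then obtain j where j: "j \<in> {1..m}" "x \<in> E j" "j \<noteq> i" using none(2) by blast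
      \<comment> \<open>Two edges through \<open>x\<close> are consecutive, with \<open>p\<close>
        the smaller index. No third edge is within distance one of both, so the type is
        \<open>{p, Suc p}\<close>.\<close>
      define p where "p = min i j"
      have p: "p \<in> {1..<m}" "x \<in> E p" "x \<in> E (Suc p)"
      proof -
        have "i = Suc j \<or> j = Suc i" using adj[of x i j] x j by blast
        then show "p \<in> {1..<m}" "x \<in> E p" "x \<in> E (Suc p)" using x j by (auto simp: p_def)
      qed
      have "q = p \<or> q = Suc p" if "q \<in> {1..m}" "x \<in> E q" for q
        using adj[of x p q] adj[of x "Suc p" q] p that by auto
      then have "S = {p, Suc p}" using x(1) p by auto
      then show False using none(1) p by blast
    qed
    then have "card ?T = 0" by (simp only: card.empty)
    then show ?thesis using none False by (simp only: if_False)
  qed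
qed

text \<open>Equal type counts give a type-preserving bijection. It sends edges to edges because
  \<open>x \<in> E i\<close> says that \<open>i\<close> belongs to the type of
  \<open>x\<close>.\<close>

lemma loose_path_iso:
  assumes V: "loose_path_labelling r m V E" and W: "loose_path_labelling r m W D"
  shows "\<exists>f. bij_betw f V W \<and> (\<forall>i\<in>{1..m}. f ` E i = D i)"
proof -
  have fin: "finite V" "finite W" and sub: "\<And>i. i \<in> {1..m} \<Longrightarrow> E i \<subseteq> V" "\<And>i. i \<in> {1..m} \<Longrightarrow> D i \<subseteq> W"
    using V W by (auto simp: loose_path_labelling_def uniform_hypergraph_def)
  obtain f where f: "bij_betw f V W" "\<And>x. x \<in> V \<Longrightarrow> {i \<in> {1..m}. f x \<in> D i} = {i \<in> {1..m}. x \<in> E i}"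
    using bij_betw_preserving_types[OF fin, of "\<lambda>x. {i \<in> {1..m}. x \<in> E i}" "\<lambda>y. {i \<in> {1..m}. y \<in> D i}"]
      card_loose_path_type[OF V] card_loose_path_type[OF W] by auto
  have "f ` E i = D i" if i: "i \<in> {1..m}" for i
  proof -
    have *: "f x \<in> D i \<longleftrightarrow> x \<in> E i" if "x \<in> V" for x using f(2)[OF that] i by blast
    have "y \<in> f ` E i" if "y \<in> D i" for y
    proof -
      from that have "y \<in> f ` V" using sub(2)[OF i] bij_betw_imp_surj_on[OF f(1)] by blast
      then show ?thesis using * that by blast
    qed
    then show ?thesis using * sub(1)[OF i] by blast
  qed
  then show ?thesis using f(1) by blast
qed

lemma blue_image:
  assumes "inj_on f V" "B \<subseteq> V" "e \<subseteq> V"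
  shows "blue (f ` B) (f ` e) = blue B e"
proof -
  have "f x \<in> f ` B \<longleftrightarrow> x \<in> B" if "x \<in> e" for x
    using that assms by (intro inj_on_image_mem_iff[OF assms(1)]) auto
  then show ?thesis unfolding blue_def image_subset_iff by blast
qed

lemma path_blue_subpath_cong:
  assumes "\<And>i. i \<in> {1..m} \<Longrightarrow> blue B (E i) = blue B' (E' i)"
  shows "path_blue_subpath k m E B = path_blue_subpath k m E' B'"
proof -
  have "(\<forall>t\<in>{1..k}. blue B (E (s + t))) = (\<forall>t\<in>{1..k}. blue B' (E' (s + t)))" if "s + k \<le> m" for s
    using that by (intro ball_cong refl assms) auto
  then show ?thesis unfolding path_blue_subpath_def by blast
qed

text \<open>An isomorphism preserves blueness of edges, so the counts depend on the path only
  through \<open>r\<close> and \<open>m\<close>. This is why segments of the cycle may be replaced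
  by the arbitrary paths of the theorem.\<close>

lemma
  assumes V: "loose_path_labelling r m V E" and W: "loose_path_labelling r m W D"
  shows F_count_eq: "F_count k m V E j = F_count k m W D j"
    and F_init_count_eq: "F_init_count k l m V E j = F_init_count k l m W D j"
proof -
  obtain f where f: "bij_betw f V W" "\<And>i. i \<in> {1..m} \<Longrightarrow> f ` E i = D i"
    using loose_path_iso[OF V W] by blast
  have b: "blue (f ` B) (D i) = blue B (E i)" if "B \<subseteq> V" "i \<in> {1..m}" for B i
    unfolding f(2)[OF that(2), symmetric]
    using V that bij_betw_imp_inj_on[OF f(1)]
    by (intro blue_image) (auto simp: loose_path_labelling_def uniform_hypergraph_def)
  have p: "path_blue_subpath k m D (f ` B) = path_blue_subpath k m E B" if "B \<subseteq> V" for B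
    using b that by (intro path_blue_subpath_cong) auto
  show "F_count k m V E j = F_count k m W D j"
    unfolding F_count_def using p by (intro num_colorings_bij[OF f(1)]) auto
  \<comment> \<open>The conjunct \<open>l < m\<close> keeps the index \<open>l + 1\<close> in the
    range where \<open>f\<close> maps edges to edges.\<close>
  have "(l < m \<and> (\<forall>i\<in>{1..l}. blue (f ` B) (D i)) \<and> \<not> blue (f ` B) (D (l + 1))) =
      (l < m \<and> (\<forall>i\<in>{1..l}. blue B (E i)) \<and> \<not> blue B (E (l + 1)))" if "B \<subseteq> V" for B
    using b[OF that] by auto
  then show "F_init_count k l m V E j = F_init_count k l m W D j"
    unfolding F_init_count_def using p by (intro num_colorings_bij[OF f(1)]) presburger
qed

section \<open>Colorings of disjoint unions\<close>

lemma num_colorings_subsets: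
  assumes "finite X"
  shows "num_colorings X (\<lambda>_. True) (int i) = card X choose i"
proof -
  have "{B \<in> colorings X (int i). True} = {B. B \<subseteq> X \<and> card B = i}" by (auto simp: colorings_def)
  then show ?thesis using n_subsets[OF assms] by simp
qed

text \<open>A coloring of a disjoint union is a pair of colorings, sorted here by the number
  \<open>i\<close> of blue vertices in \<open>X\<close>. The bound \<open>m\<close> is required only
  of sets satisfying \<open>P\<close>, so that the sum can stop below \<open>card X\<close>.\<close>

lemma num_colorings_product:
  assumes fin: "finite X" "finite Y" and disj: "X \<inter> Y = {}"
    and m: "\<And>A. A \<subseteq> X \<Longrightarrow> P A \<Longrightarrow> card A \<le> m"
  shows "num_colorings (X \<union> Y) (\<lambda>B. P (B \<inter> X) \<and> Q (B \<inter> Y)) j =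
    (\<Sum>i=0..m. num_colorings X P (int i) * num_colorings Y Q (j - int i))"
proof -
  let ?S = "\<lambda>i. {A \<in> colorings X (int i). P A} \<times> {B \<in> colorings Y (j - int i). Q B}"
  let ?f = "\<lambda>(A, B). A \<union> B"
  have cU: "card (A \<union> B) = card A + card B" if "A \<subseteq> X" "B \<subseteq> Y" for A B
    using that fin disj by (intro card_Un_disjoint) (auto intro: finite_subset)
  have B: "B = B \<inter> X \<union> B \<inter> Y" "card B = card (B \<inter> X) + card (B \<inter> Y)" if "B \<subseteq> X \<union> Y" for B
    using that cU[of "B \<inter> X" "B \<inter> Y"] by (auto simp: Int_Un_distrib[symmetric] Int_absorb2)
  have "inj_on ?f (Pow X \<times> Pow Y)"
    using disj by (intro inj_onI) (auto; blast)
  then have inj: "inj_on ?f (\<Union>i\<in>{0..m}. ?S i)"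
    by (rule inj_on_subset) (auto simp: colorings_def)
  have "{B \<in> colorings (X \<union> Y) j. P (B \<inter> X) \<and> Q (B \<inter> Y)} = ?f ` (\<Union>i\<in>{0..m}. ?S i)"
  proof (intro set_eqI iffI)
    fix B assume "B \<in> {B \<in> colorings (X \<union> Y) j. P (B \<inter> X) \<and> Q (B \<inter> Y)}"
    then have b: "B \<subseteq> X \<union> Y" "int (card B) = j" "P (B \<inter> X)" "Q (B \<inter> Y)" by (auto simp: colorings_def)
    then have "(B \<inter> X, B \<inter> Y) \<in> ?S (card (B \<inter> X))" using B(2) by (auto simp: colorings_def)
    moreover have "card (B \<inter> X) \<in> {0..m}" using m[of "B \<inter> X"] b by simp
    ultimately show "B \<in> ?f ` (\<Union>i\<in>{0..m}. ?S i)" using B(1)[OF b(1)]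
      by (intro image_eqI[of _ _ "(B \<inter> X, B \<inter> Y)"] UN_I[of "card (B \<inter> X)"]) simp_all
  next
    fix C assume "C \<in> ?f ` (\<Union>i\<in>{0..m}. ?S i)"
    then obtain A B where C: "C = A \<union> B" "A \<subseteq> X" "P A" "B \<subseteq> Y" "Q B" "int (card A + card B) = j"
      by (auto simp: colorings_def)
    moreover have "C \<inter> X = A" "C \<inter> Y = B" using C disj by auto
    ultimately show "C \<in> {B \<in> colorings (X \<union> Y) j. P (B \<inter> X) \<and> Q (B \<inter> Y)}"
      using cU by (auto simp: colorings_def)
  qed
  then have "num_colorings (X \<union> Y) (\<lambda>B. P (B \<inter> X) \<and> Q (B \<inter> Y)) j = card (\<Union>i\<in>{0..m}. ?S i)"
    using card_image[OF inj] by simp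
  also have "\<dots> = (\<Sum>i=0..m. card (?S i))"
    by (intro card_UN_disjoint ballI impI finite_cartesian_product finite_colorings fin)
      (auto simp: colorings_def)
  finally show ?thesis by (simp add: card_cartesian_product)
qed

lemma num_colorings_cong:
  assumes "V = V'" "j = j'" "\<And>B. B \<subseteq> V' \<Longrightarrow> Q B = Q' B"
  shows "num_colorings V Q j = num_colorings V' Q' j'"
  using assms by (auto simp: colorings_def intro!: arg_cong[of _ _ card])

text \<open>The block \<open>Z\<close> may carry any blue set except \<open>Z\<close> itself, whence
  the upper limit \<open>card Z - 1\<close>. The assumption on \<open>Q\<close> says that it depends
  only on the colors in \<open>Y\<close>.\<close>

lemma num_colorings_split_proper:
  assumes fin: "finite Z" "finite Y" and "Z \<inter> Y = {}" and Z: "Z \<noteq> {}"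
    and Q: "\<And>B. B \<subseteq> Z \<union> Y \<Longrightarrow> Q (B \<inter> Y) = Q B"
  shows "num_colorings (Z \<union> Y) (\<lambda>B. \<not> Z \<subseteq> B \<and> Q B) j =
    (\<Sum>i=0..card Z - 1. (card Z choose i) * num_colorings Y Q (j - int i))"
proof -
  have lt: "card A < card Z" if "A \<subseteq> Z" "\<not> Z \<subseteq> A" for A
    using that fin by (intro psubset_card_mono) auto
  have "num_colorings (Z \<union> Y) (\<lambda>B. \<not> Z \<subseteq> B \<and> Q B) j =
      num_colorings (Z \<union> Y) (\<lambda>B. \<not> Z \<subseteq> B \<inter> Z \<and> Q (B \<inter> Y)) j"
    using Q by (intro num_colorings_cong) auto
  also have "\<dots> = (\<Sum>i=0..card Z - 1. num_colorings Z (\<lambda>A. \<not> Z \<subseteq> A) (int i) * num_colorings Y Q (j - int i))"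
  proof (intro num_colorings_product assms)
    fix A assume "A \<subseteq> Z" "\<not> Z \<subseteq> A"
    from lt[OF this] show "card A \<le> card Z - 1" by simp
  qed
  also have "\<dots> = (\<Sum>i=0..card Z - 1. (card Z choose i) * num_colorings Y Q (j - int i))"
  proof (intro sum.cong refl arg_cong2[where f = "(*)"])
    fix i assume "i \<in> {0..card Z - 1}"
    then have "i < card Z" using Z fin card_gt_0_iff[of Z] by simp
    \<comment> \<open>A subset of size \<open>i < card Z\<close> cannot be all of \<open>Z\<close>,
      so the condition excludes nothing at this size.\<close>
    then have "{B \<in> colorings Z (int i). \<not> Z \<subseteq> B} = {B \<in> colorings Z (int i). True}"
      using fin card_mono[of _ Z] by (auto simp: colorings_def dest: finite_subset)
    then show "num_colorings Z (\<lambda>A. \<not> Z \<subseteq> A) (int i) = card Z choose i"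
      using num_colorings_subsets[OF fin(1)] by simp
  qed
  finally show ?thesis .
qed

text \<open>\<open>T\<close> is forced blue, \<open>R\<close> forced red, \<open>X\<close> is free
  and \<open>Y\<close> carries the condition \<open>Q\<close>. Deleting \<open>T\<close> from the
  blue set leaves a coloring of \<open>X \<union> Y\<close> with \<open>card T\<close> fewer blue
  vertices, to which the product formula applies.\<close>

lemma num_colorings_split:
  assumes fin: "finite T" "finite R" "finite X" "finite Y"
    and disj: "T \<inter> R = {}" "T \<inter> X = {}" "T \<inter> Y = {}" "R \<inter> X = {}" "R \<inter> Y = {}" "X \<inter> Y = {}"
    and V: "V = T \<union> R \<union> X \<union> Y"
    and Q: "\<And>B. B \<subseteq> V \<Longrightarrow> Q (B \<inter> Y) = Q B"
  shows "num_colorings V (\<lambda>B. T \<subseteq> B \<and> B \<inter> R = {} \<and> Q B) j =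
    (\<Sum>i=0..card X. (card X choose i) * num_colorings Y Q (j - int (card T) - int i))"
proof -
  let ?U = "{B \<in> colorings (X \<union> Y) (j - int (card T)). True \<and> Q (B \<inter> Y)}"
  have cT: "card (T \<union> B) = card T + card B" if "B \<subseteq> X \<union> Y" for B
    using that fin disj by (intro card_Un_disjoint) (auto intro: finite_subset)
  have "bij_betw (\<lambda>B. T \<union> B) ?U {B \<in> colorings V j. T \<subseteq> B \<and> B \<inter> R = {} \<and> Q B}"
  proof (rule bij_betw_byWitness[where f' = "\<lambda>B. B - T"])
    show "\<forall>B\<in>?U. T \<union> B - T = B" using disj by (auto simp: colorings_def)
    show "\<forall>B\<in>{B \<in> colorings V j. T \<subseteq> B \<and> B \<inter> R = {} \<and> Q B}. T \<union> (B - T) = B" by auto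
    show "(\<union>) T ` ?U \<subseteq> {B \<in> colorings V j. T \<subseteq> B \<and> B \<inter> R = {} \<and> Q B}"
    proof (rule image_subsetI)
      fix B assume "B \<in> ?U"
      then have B: "B \<subseteq> X \<union> Y" "int (card B) = j - int (card T)" "Q (B \<inter> Y)"
        by (auto simp: colorings_def)
      have "(T \<union> B) \<inter> Y = B \<inter> Y" using disj by auto
      then have "Q (T \<union> B)" using Q[of "T \<union> B"] B V by auto
      then show "T \<union> B \<in> {B \<in> colorings V j. T \<subseteq> B \<and> B \<inter> R = {} \<and> Q B}"
        using B cT disj V by (auto simp: colorings_def)
    qed
    show "(\<lambda>B. B - T) ` {B \<in> colorings V j. T \<subseteq> B \<and> B \<inter> R = {} \<and> Q B} \<subseteq> ?U"
    proof (rule image_subsetI)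
      fix B assume "B \<in> {B \<in> colorings V j. T \<subseteq> B \<and> B \<inter> R = {} \<and> Q B}"
      then have B: "B \<subseteq> V" "int (card B) = j" "T \<subseteq> B" "B \<inter> R = {}" "Q B" by (auto simp: colorings_def)
      have sub: "B - T \<subseteq> X \<union> Y" using B V by auto
      have "T \<union> (B - T) = B" using B by auto
      then have "card B = card T + card (B - T)" using cT[OF sub] by simp
      moreover have "(B - T) \<inter> Y = B \<inter> Y" using disj by auto
      ultimately show "B - T \<in> ?U" using Q[OF B(1)] B sub by (auto simp: colorings_def)
    qed
  qed
  then have "num_colorings V (\<lambda>B. T \<subseteq> B \<and> B \<inter> R = {} \<and> Q B) j = card ?U"
    using bij_betw_same_card by fastforce
  also have "\<dots> = (\<Sum>i=0..card X. num_colorings X (\<lambda>_. True) (int i) * num_colorings Y Q (j - int (card T) - int i))"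
    by (rule num_colorings_product[where P = "\<lambda>_. True"]) (use fin disj card_mono in auto)
  finally show ?thesis by (simp only: num_colorings_subsets[OF fin(3)])
qed

section \<open>Blue subpaths\<close>

text \<open>A nonempty run starting at the first edge would contain the non-blue one, so every run
  starts later. The offset \<open>a\<close> allows repeated removal.\<close>

lemma path_blue_subpath_drop_first:
  assumes "\<not> blue B (E (Suc a))" "k \<ge> 1"
  shows "path_blue_subpath k (Suc m) (\<lambda>i. E (a + i)) B = path_blue_subpath k m (\<lambda>i. E (Suc a + i)) B"
proof
  assume "path_blue_subpath k (Suc m) (\<lambda>i. E (a + i)) B"
  then obtain s where s: "s + k \<le> Suc m" "\<And>t. t \<in> {1..k} \<Longrightarrow> blue B (E (a + (s + t)))"
    by (auto simp: path_blue_subpath_def)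
  have "s \<noteq> 0" using s(2)[of 1] assms by (intro notI) auto
  then obtain s' where "s = Suc s'" by (cases s) auto
  then show "path_blue_subpath k m (\<lambda>i. E (Suc a + i)) B"
    using s by (auto simp: path_blue_subpath_def intro!: exI[of _ s'])
next
  assume "path_blue_subpath k m (\<lambda>i. E (Suc a + i)) B"
  then obtain s where "s + k \<le> m" "\<forall>t\<in>{1..k}. blue B (E (Suc a + (s + t)))"
    by (auto simp: path_blue_subpath_def)
  then show "path_blue_subpath k (Suc m) (\<lambda>i. E (a + i)) B"
    by (auto simp: path_blue_subpath_def intro!: exI[of _ "Suc s"])
qed

lemma path_blue_subpath_drop_last:
  assumes "\<not> blue B (E (Suc m))" "k \<ge> 1"
  shows "path_blue_subpath k (Suc m) E B = path_blue_subpath k m E B"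
proof
  assume "path_blue_subpath k (Suc m) E B"
  then obtain s where s: "s + k \<le> Suc m" "\<And>t. t \<in> {1..k} \<Longrightarrow> blue B (E (s + t))"
    by (auto simp: path_blue_subpath_def)
  have "s + k \<noteq> Suc m" using s(2)[of k] assms by auto
  then show "path_blue_subpath k m E B"
    using s by (auto simp: path_blue_subpath_def intro!: exI[of _ s])
qed (unfold path_blue_subpath_def, metis le_SucI)

lemma path_blue_subpath_reverse_imp:
  assumes "path_blue_subpath k m E B"
  shows "path_blue_subpath k m (\<lambda>i. E (Suc m - i)) B"
proof -
  obtain s where s: "s + k \<le> m" "\<And>t. t \<in> {1..k} \<Longrightarrow> blue B (E (s + t))"
    using assms by (auto simp: path_blue_subpath_def)
  \<comment> \<open>In the reversed numbering the edges \<open>s + 1\<close> to \<open>s + k\<close>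
    become \<open>m - s - k + 1\<close> to \<open>m - s\<close>, in opposite order.\<close>
  have "blue B (E (Suc m - (m - s - k + t)))" if "t \<in> {1..k}" for t
  proof -
    have "Suc m - (m - s - k + t) = s + (Suc k - t)" "Suc k - t \<in> {1..k}" using s(1) that by auto
    then show ?thesis using s(2) by simp
  qed
  then show ?thesis using s(1)
    unfolding path_blue_subpath_def by (intro exI[of _ "m - s - k"]) auto
qed

text \<open>Reversal is an involution on the indices \<open>1\<close> to \<open>m\<close>, so the
  implication applied to the reversed labelling yields the converse.\<close>

lemma path_blue_subpath_reverse:
  "path_blue_subpath k m (\<lambda>i. E (Suc m - i)) B = path_blue_subpath k m E B"
proof
  assume "path_blue_subpath k m (\<lambda>i. E (Suc m - i)) B"
  from path_blue_subpath_reverse_imp[OF this] show "path_blue_subpath k m E B"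
    by (subst path_blue_subpath_cong[of m B E B "\<lambda>i. E (Suc m - (Suc m - i))"]) auto
qed (rule path_blue_subpath_reverse_imp)

text \<open>A cyclic run that avoids edge \<open>n\<close> cannot wrap around, so it is a run of the
  linear path.\<close>

lemma cycle_blue_subpath_nonblue_last:
  assumes "k \<ge> 1" "k < n" and last: "\<not> blue B (E n)"
  shows "cycle_blue_subpath k n E B = path_blue_subpath k (n - 1) E B"
proof
  assume "cycle_blue_subpath k n E B"
  then obtain s where s: "\<And>t. t < k \<Longrightarrow> blue B (E ((s + t) mod n + 1))"
    unfolding cycle_blue_subpath_def by (metis atLeastLessThan_iff zero_le)
  define q where "q = s mod n"
  have q: "q < n" using assms by (simp add: q_def)
  have sq: "blue B (E ((q + t) mod n + 1))" if "t < k" for t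
    using s[OF that] by (simp add: q_def mod_simps)
  \<comment> \<open>The run starts at edge \<open>q + 1\<close>, so edge \<open>n\<close> has offset
    \<open>n - 1 - q\<close>; if this were below \<open>k\<close>, edge \<open>n\<close> would be
    blue.\<close>
  have le: "q + k \<le> n - 1"
  proof (rule ccontr)
    assume "\<not> ?thesis"
    then have "n - 1 - q < k" using assms by linarith
    moreover have "(q + (n - 1 - q)) mod n + 1 = n" using q assms by auto
    ultimately show False using sq last by metis
  qed
  have "blue B (E (q + t))" if "t \<in> {1..k}" for t
  proof -
    have "(q + (t - 1)) mod n + 1 = q + t" using that le by auto
    moreover have "t - 1 < k" using that by auto
    ultimately show ?thesis using sq by metis
  qed
  then show "path_blue_subpath k (n - 1) E B" using le by (auto simp: path_blue_subpath_def)
next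
  assume "path_blue_subpath k (n - 1) E B"
  then obtain s where s: "s + k \<le> n - 1" "\<And>t. t \<in> {1..k} \<Longrightarrow> blue B (E (s + t))"
    by (auto simp: path_blue_subpath_def)
  have "blue B (E ((s + t) mod n + 1))" if "t < k" for t
    using s(1) s(2)[of "Suc t"] that by auto
  then have "\<forall>t\<in>{0..<k}. blue B (E ((s + t) mod n + 1))" by simp
  then show "cycle_blue_subpath k n E B" using assms unfolding cycle_blue_subpath_def by auto
qed

text \<open>The initial stretch of blue edges has a unique length \<open>l\<close>. It is at least
  \<open>1\<close> because the first edge is blue, and less than \<open>k\<close> because no run of
  length \<open>k\<close> exists.\<close>

lemma num_colorings_first_blue:
  assumes "finite V" "k \<ge> 1" "k \<le> m"
  shows "num_colorings V (\<lambda>B. blue B (E 1) \<and> \<not> path_blue_subpath k m E B) j =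
    (\<Sum>l=1..k - 1. F_init_count k l m V E j)"
proof -
  let ?Q = "\<lambda>l B. \<not> path_blue_subpath k m E B \<and> l < m \<and> (\<forall>i\<in>{1..l}. blue B (E i)) \<and> \<not> blue B (E (l + 1))"
  have uniq: "l = l'" if "?Q l B" "?Q l' B" for l l' B
  proof (rule ccontr)
    assume "l \<noteq> l'"
    then consider "l < l'" | "l' < l" by linarith
    then show False
    proof cases
      case 1
      then have "l + 1 \<in> {1..l'}" by simp
      then show False using that by blast
    next
      case 2
      then have "l' + 1 \<in> {1..l}" by simp
      then show False using that by blast
    qed
  qed
  have ex: "\<exists>l\<in>{1..k - 1}. ?Q l B" if "blue B (E 1)" "\<not> path_blue_subpath k m E B" for B
  proof -
    \<comment> \<open>Otherwise the first \<open>k\<close> edges, which exist since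
      \<open>k \<le> m\<close>, would form a blue subpath starting at \<open>s = 0\<close>.\<close>
    have "\<exists>t\<in>{1..k}. \<not> blue B (E (0 + t))"
      using that(2) assms unfolding path_blue_subpath_def by (metis add_0)
    then obtain t where "t \<in> {1..k}" "\<not> blue B (E t)" by auto
    then have ne: "\<exists>l. l < k \<and> \<not> blue B (E (l + 1))" by (intro exI[of _ "t - 1"]) auto
    then obtain l where l: "l < k" "\<not> blue B (E (l + 1))"
      and least: "\<And>i. i < l \<Longrightarrow> \<not> (i < k \<and> \<not> blue B (E (i + 1)))"
      using exists_least_iff[of "\<lambda>l. l < k \<and> \<not> blue B (E (l + 1))"] by blast
    have "blue B (E i)" if "i \<in> {1..l}" for i
      using least[of "i - 1"] that l(1) by auto
    moreover have "l \<noteq> 0" using l(2) that(1) by (intro notI) simp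
    ultimately have "l \<in> {1..k - 1}" "?Q l B" using l that assms by auto
    then show ?thesis by blast
  qed
  have eq: "{B \<in> colorings V j. blue B (E 1) \<and> \<not> path_blue_subpath k m E B} =
      (\<Union>l\<in>{1..k - 1}. {B \<in> colorings V j. ?Q l B})"
  proof (intro set_eqI iffI)
    fix B assume "B \<in> {B \<in> colorings V j. blue B (E 1) \<and> \<not> path_blue_subpath k m E B}"
    then show "B \<in> (\<Union>l\<in>{1..k - 1}. {B \<in> colorings V j. ?Q l B})" using ex[of B] by blast
  next
    fix B assume "B \<in> (\<Union>l\<in>{1..k - 1}. {B \<in> colorings V j. ?Q l B})"
    then obtain l where "1 \<le> l" "B \<in> colorings V j" "?Q l B" by auto
    then show "B \<in> {B \<in> colorings V j. blue B (E 1) \<and> \<not> path_blue_subpath k m E B}" by simp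
  qed
  show ?thesis unfolding eq F_init_count_def
  proof (intro card_UN_disjoint ballI impI finite_colorings assms finite_atLeastAtMost)
    fix l l' :: nat assume "l \<noteq> l'"
    then have "\<not> (?Q l B \<and> ?Q l' B)" for B using uniq[where l = l and l' = l' and B = B] by fast
    then show "{B \<in> colorings V j. ?Q l B} \<inter> {B \<in> colorings V j. ?Q l' B} = {}" by fast
  qed
qed

section \<open>Coordinates on a loose cycle\<close>

text \<open>The edges are \<open>edge i\<close> for \<open>0 < i < n\<close> and \<open>insert (v 0) (insert (v (n - 1)) (P n))\<close>, whose
  index \<open>n\<close> would make \<open>edge\<close> refer to the meaningless \<open>v n\<close>. The vertex \<open>v i\<close> is shared by the
  edges \<open>i\<close> and \<open>i + 1\<close>, and \<open>P i\<close> consists of the vertices of degree 1 of the edge \<open>i\<close>. The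
  set \<open>seg a m\<close> carries the path formed by the edges \<open>a + 1, \<dots>, a + m\<close>.\<close>

locale cycle_coords =
  fixes r n :: nat and v :: "nat \<Rightarrow> 'a" and P :: "nat \<Rightarrow> 'a set"
  assumes r: "r > 2" and v_inj: "inj_on v {..<n}"
    and P_fin: "i \<in> {1..n} \<Longrightarrow> finite (P i)"
    and P_card: "i \<in> {1..n} \<Longrightarrow> card (P i) = r - 2"
    and P_disj: "i \<in> {1..n} \<Longrightarrow> j \<in> {1..n} \<Longrightarrow> i \<noteq> j \<Longrightarrow> P i \<inter> P j = {}"
    and v_P: "i < n \<Longrightarrow> j \<in> {1..n} \<Longrightarrow> v i \<notin> P j"
begin

definition edge :: "nat \<Rightarrow> 'a set" where
  "edge i = insert (v (i - 1)) (insert (v i) (P i))"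

definition seg :: "nat \<Rightarrow> nat \<Rightarrow> 'a set" where
  "seg a m = v ` {a..a + m} \<union> (\<Union>i\<in>{a<..a + m}. P i)"

lemma v_eq: "i < n \<Longrightarrow> j < n \<Longrightarrow> v i = v j \<longleftrightarrow> i = j"
  using v_inj by (auto simp: inj_on_def)

lemma seg_Suc: "seg a (Suc m) = insert (v a) (P (Suc a)) \<union> seg (Suc a) m"
proof -
  have "{a..a + Suc m} = insert a {Suc a..Suc a + m}" "{a<..a + Suc m} = insert (Suc a) {Suc a<..Suc a + m}"
    by auto
  then show ?thesis by (auto simp: seg_def)
qed

lemma seg_Suc_right: "seg a (Suc m) = seg a m \<union> insert (v (a + Suc m)) (P (a + Suc m))"
proof -
  have "{a..a + Suc m} = insert (a + Suc m) {a..a + m}" "{a<..a + Suc m} = insert (a + Suc m) {a<..a + m}"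
    by auto
  then show ?thesis by (auto simp: seg_def)
qed

lemma finite_seg: "a + m < n \<Longrightarrow> finite (seg a m)"
  using P_fin by (auto simp: seg_def)

lemma v_notin_seg: "i < n \<Longrightarrow> a + m < n \<Longrightarrow> i < a \<or> a + m < i \<Longrightarrow> v i \<notin> seg a m"
  using v_P[of i] by (auto simp: seg_def v_eq)

lemma P_seg: "i \<in> {1..n} \<Longrightarrow> a + m < n \<Longrightarrow> i \<le> a \<or> a + m < i \<Longrightarrow> P i \<inter> seg a m = {}"
proof -
  assume *: "i \<in> {1..n}" "a + m < n" "i \<le> a \<or> a + m < i"
  have "v l \<notin> P i" if "l \<in> {a..a + m}" for l using that * by (intro v_P) auto
  moreover have "P i \<inter> P l = {}" if "l \<in> {a<..a + m}" for l using that * by (intro P_disj) auto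
  ultimately show ?thesis unfolding seg_def by blast
qed

lemma edge_subset_seg: "i \<in> {1..m} \<Longrightarrow> edge (a + i) \<subseteq> seg a m"
proof -
  assume "i \<in> {1..m}"
  then have "a + i - 1 \<in> {a..a + m}" "a + i \<in> {a..a + m}" "a + i \<in> {a<..a + m}" by auto
  then show ?thesis unfolding edge_def seg_def by blast
qed

lemma card_edge: "i \<in> {1..<n} \<Longrightarrow> card (edge i) = r"
  using v_P[of i i] v_P[of "i - 1" i] P_fin[of i] P_card[of i] v_eq[of "i - 1" i] r
  by (auto simp: edge_def)

text \<open>No \<open>v l\<close> lies in any of the sets \<open>P\<close>, so the two kinds of
  vertices can be intersected separately. Successor indices avoid the subtraction in
  \<open>edge\<close>.\<close>

lemma edge_Int:
  assumes "Suc i < n" "Suc j < n"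
  shows "edge (Suc i) \<inter> edge (Suc j) = v ` ({i, Suc i} \<inter> {j, Suc j}) \<union> (P (Suc i) \<inter> P (Suc j))"
proof -
  have "v ` {i, Suc i} \<inter> v ` {j, Suc j} = v ` ({i, Suc i} \<inter> {j, Suc j})"
    using assms by (intro inj_on_image_Int[OF v_inj, symmetric]) auto
  moreover have "edge (Suc l) = v ` {l, Suc l} \<union> P (Suc l)" for l by (simp add: edge_def)
  moreover have "v ` {i, Suc i} \<inter> P (Suc j) = {}" "P (Suc i) \<inter> v ` {j, Suc j} = {}"
    using v_P assms by auto
  ultimately show ?thesis by (simp only: Int_Un_distrib Int_Un_distrib2 Un_empty_right Un_empty_left)
qed

lemma edge_Int_Suc:
  assumes "i \<in> {1..<n}" "Suc i \<in> {1..<n}"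
  shows "edge i \<inter> edge (Suc i) = {v i}"
proof -
  obtain i' where i: "i = Suc i'" using assms by (cases i) auto
  have "{i', Suc i'} \<inter> {Suc i', Suc (Suc i')} = {Suc i'}" by auto
  then show ?thesis using edge_Int[of i' "Suc i'"] P_disj[of i "Suc i"] assms by (simp add: i)
qed

lemma edge_Int_far:
  assumes "i \<in> {1..<n}" "j \<in> {1..<n}" "Suc i < j"
  shows "edge i \<inter> edge j = {}"
proof -
  obtain i' j' where *: "i = Suc i'" "j = Suc j'" using assms by (cases i; cases j) auto
  have "{i', Suc i'} \<inter> {j', Suc j'} = {}" using assms * by auto
  then show ?thesis using edge_Int[of i' j'] P_disj[of i j] assms by (simp add: *)
qed

text \<open>The bound \<open>a + m < n\<close> keeps edge \<open>n\<close> out of the segment, so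
  the cycle never closes up. This makes the remaining pieces comparable with arbitrary loose
  paths.\<close>

lemma seg_labelling:
  assumes "a + m < n"
  shows "loose_path_labelling r m (seg a m) (\<lambda>i. edge (a + i))"
proof -
  have near: "card (edge (a + i) \<inter> edge (a + j)) = 1"
    if "i \<in> {1..m}" "j \<in> {1..m}" "\<bar>int i - int j\<bar> = 1" for i j
  proof -
    have "j = Suc i \<or> i = Suc j" using that by linarith
    then show ?thesis
      using edge_Int_Suc[of "a + i"] edge_Int_Suc[of "a + j"] that assms by (auto simp: Int_commute)
  qed
  have far: "edge (a + i) \<inter> edge (a + j) = {}"
    if "i \<in> {1..m}" "j \<in> {1..m}" "\<bar>int i - int j\<bar> \<ge> 2" for i j
  proof -
    have "Suc i < j \<or> Suc j < i" using that by linarith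
    then show ?thesis
      using edge_Int_far[of "a + i" "a + j"] edge_Int_far[of "a + j" "a + i"] that assms
      by (auto simp: Int_commute)
  qed
  have card: "card (edge (a + i)) = r" if "i \<in> {1..m}" for i
    using that assms by (intro card_edge) auto
  have "inj_on (\<lambda>i. edge (a + i)) {1..m}"
  \<comment> \<open>Edges with distinct indices meet in at most one vertex, whereas equal edges
    would meet in \<open>r > 2\<close>.\<close>
  proof (rule inj_onI, rule ccontr)
    fix i j assume ij: "i \<in> {1..m}" "j \<in> {1..m}" "edge (a + i) = edge (a + j)" "i \<noteq> j"
    then have "\<bar>int i - int j\<bar> = 1 \<or> \<bar>int i - int j\<bar> \<ge> 2" by linarith
    then have "card (edge (a + i) \<inter> edge (a + j)) \<le> 1" using near far ij(1,2) by fastforce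
    then show False using card[OF ij(1)] ij(3) r by simp
  qed
  moreover have "seg a m = \<Union> ((\<lambda>i. edge (a + i)) ` {1..m})" if "m > 0"
  proof
    show "\<Union> ((\<lambda>i. edge (a + i)) ` {1..m}) \<subseteq> seg a m" using edge_subset_seg by blast
    have "v i \<in> \<Union> ((\<lambda>i. edge (a + i)) ` {1..m})" if "i \<in> {a..a + m}" for i
    proof (cases "i = a")
      case True
      then have "v i \<in> edge (a + 1)" by (simp add: edge_def)
      then show ?thesis using \<open>m > 0\<close> by (intro UN_I[of 1]) auto
    next
      case False
      have "v i \<in> edge (a + (i - a))" using that by (simp add: edge_def)
      then show ?thesis using False that by (intro UN_I[of "i - a"]) auto
    qed
    moreover have "P i \<subseteq> \<Union> ((\<lambda>i. edge (a + i)) ` {1..m})" if "i \<in> {a<..a + m}" for i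
    proof -
      have "P i \<subseteq> edge (a + (i - a))" using that by (auto simp: edge_def)
      then show ?thesis using that by (intro SUP_upper2[of "i - a"]) auto
    qed
    ultimately show "seg a m \<subseteq> \<Union> ((\<lambda>i. edge (a + i)) ` {1..m})" unfolding seg_def by blast
  qed
  moreover have "card (seg a m) = 1" if "m = 0" using that by (simp add: seg_def)
  moreover have "uniform_hypergraph r (seg a m) ((\<lambda>i. edge (a + i)) ` {1..m})"
    using finite_seg[OF assms] card edge_subset_seg by (auto simp: uniform_hypergraph_def)
  ultimately show ?thesis using near far unfolding loose_path_labelling_def by simp
qed

definition blue_subpath :: "nat \<Rightarrow> nat \<Rightarrow> nat \<Rightarrow> 'a set \<Rightarrow> bool" where
  "blue_subpath k a m B \<longleftrightarrow> path_blue_subpath k m (\<lambda>i. edge (a + i)) B"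

text \<open>All edges involved lie inside \<open>Y\<close>. This supplies the locality assumption on
  \<open>Q\<close> in the splitting lemmas.\<close>

lemma blue_subpath_Int:
  assumes "seg a m \<subseteq> Y"
  shows "blue_subpath k a m (B \<inter> Y) = blue_subpath k a m B"
  unfolding blue_subpath_def
proof (rule path_blue_subpath_cong)
  fix i assume "i \<in> {1..m}"
  from edge_subset_seg[OF this] assms have "edge (a + i) \<subseteq> Y" by blast
  then show "blue (B \<inter> Y) (edge (a + i)) = blue B (edge (a + i))" by (auto simp: blue_def)
qed

lemma blue_subpath_drop_first:
  "\<not> blue B (edge (Suc a)) \<Longrightarrow> k \<ge> 1 \<Longrightarrow> blue_subpath k a (Suc m) B = blue_subpath k (Suc a) m B"
  unfolding blue_subpath_def by (rule path_blue_subpath_drop_first)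

lemma blue_subpath_drop_last:
  "\<not> blue B (edge (a + Suc m)) \<Longrightarrow> k \<ge> 1 \<Longrightarrow> blue_subpath k a (Suc m) B = blue_subpath k a m B"
  unfolding blue_subpath_def by (rule path_blue_subpath_drop_last)

definition verts :: "'a set" where "verts = P n \<union> seg 0 (n - 1)"

section \<open>Counting each way in which edge \<open>n\<close> can fail to be blue\<close>

lemma seg_count:
  assumes "loose_path_labelling r m W D" "a + m < n"
  shows "num_colorings (seg a m) (\<lambda>B. \<not> blue_subpath k a m B) j = F_count k m W D j"
  using F_count_eq[OF seg_labelling[OF assms(2)] assms(1)] by (simp add: F_count_def blue_subpath_def)

text \<open>A red vertex in \<open>P n\<close> already makes edge \<open>n\<close> non-blue and
  imposes nothing on the other \<open>n - 1\<close> edges, so the splitting applies with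
  \<open>Z = P n\<close>.\<close>

lemma count_private_not_blue:
  assumes n: "n \<ge> 1" and W: "loose_path_labelling r (n - 1) W D"
  shows "num_colorings verts (\<lambda>B. \<not> P n \<subseteq> B \<and> \<not> blue_subpath k 0 (n - 1) B) j =
    (\<Sum>i=0..r - 3. (r - 2 choose i) * F_count k (n - 1) W D (j - int i))"
proof -
  have c: "card (P n) = r - 2" using n by (intro P_card) auto
  have "P n \<noteq> {}" using c r by (intro notI) simp
  then have "num_colorings verts (\<lambda>B. \<not> P n \<subseteq> B \<and> \<not> blue_subpath k 0 (n - 1) B) j =
    (\<Sum>i=0..card (P n) - 1. (card (P n) choose i) *
      num_colorings (seg 0 (n - 1)) (\<lambda>B. \<not> blue_subpath k 0 (n - 1) B) (j - int i))"
    unfolding verts_def using n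
    by (intro num_colorings_split_proper P_fin finite_seg P_seg)
      (auto simp: blue_subpath_Int)
  also have "\<dots> = (\<Sum>i=0..r - 3. (r - 2 choose i) * F_count k (n - 1) W D (j - int i))"
    using seg_count[OF W] n by (simp add: c)
  finally show ?thesis .
qed

lemma finite_P_Un: "i \<in> {1..n} \<Longrightarrow> l \<in> {1..n} \<Longrightarrow> finite (P i \<union> P l)"
  using P_fin by simp

lemma card_P_Un:
  assumes "i \<in> {1..n}" "l \<in> {1..n}" "i \<noteq> l"
  shows "card (P i \<union> P l) = 2 * r - 4"
  using assms by (subst card_Un_disjoint) (auto simp: P_fin P_card P_disj)

text \<open>The blocks stand in the order \<open>T\<close>, \<open>R\<close>, \<open>X\<close>,
  \<open>Y\<close> of \<open>num_colorings_split\<close>, as they do in the two decompositions that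
  follow. Writing \<open>n\<close> as a sum exposes the successors for the recursion of
  \<open>seg\<close>.\<close>

lemma verts_split_last:
  assumes "n = q + 2"
  shows "verts = P n \<union> {v (n - 1)} \<union> P (n - 1) \<union> seg 0 (n - 2)"
  unfolding verts_def using seg_Suc_right[of 0 q] assms by auto

lemma verts_split_both:
  assumes "n = q + 3"
  shows "verts = P n \<union> {v 0, v (n - 1)} \<union> (P 1 \<union> P (n - 1)) \<union> seg 1 (n - 3)"
proof -
  have "verts = P n \<union> {v (n - 1)} \<union> P (n - 1) \<union> seg 0 (n - 2)"
    using assms by (intro verts_split_last[of "q + 1"]) simp
  then show ?thesis using seg_Suc[of 0 q] assms by auto
qed

lemma verts_split_both2:
  assumes "n = q + 4"
  shows "verts = (P n \<union> {v 0} \<union> P 1) \<union> {v (n - 1), v 1} \<union> (P (n - 1) \<union> P 2) \<union> seg 2 (n - 4)"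
proof -
  have "verts = P n \<union> {v 0, v (n - 1)} \<union> (P 1 \<union> P (n - 1)) \<union> seg 1 (n - 3)"
    using assms by (intro verts_split_both[of "q + 1"]) simp
  moreover have "seg 1 (n - 3) = insert (v 1) (P 2) \<union> seg 2 (n - 4)"
    using seg_Suc[of 1 q] assms by (simp add: numeral_2_eq_2)
  ultimately show ?thesis by auto
qed

lemma not_blue_edge:
  assumes "v i \<notin> B"
  shows "\<not> blue B (edge i)" "\<not> blue B (edge (Suc i))"
  using assms by (auto simp: blue_def edge_def)

text \<open>The red ends make edges \<open>1\<close> and \<open>n - 1\<close> non-blue. Their
  \<open>2 * r - 4\<close> vertices of degree 1 become free, while \<open>P n\<close> contributes
  \<open>r - 2\<close> forced blue vertices.\<close>

lemma count_both_red:
  assumes k: "k \<ge> 1" and n: "n = q + 3" and W: "loose_path_labelling r (n - 3) W D"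
  shows "num_colorings verts
      (\<lambda>B. P n \<subseteq> B \<and> v 0 \<notin> B \<and> v (n - 1) \<notin> B \<and> \<not> blue_subpath k 0 (n - 1) B) j =
    (\<Sum>i=0..2 * r - 4. (2 * r - 4 choose i) * F_count k (n - 3) W D (j - int i - (int r - 2)))"
proof -
  have eq: "blue_subpath k 0 (n - 1) B = blue_subpath k 1 (n - 3) B"
    if "v 0 \<notin> B" "v (n - 1) \<notin> B" for B
    using blue_subpath_drop_first[OF not_blue_edge(2)[OF that(1)] k, of "Suc q"]
      blue_subpath_drop_last[of B 1 q k] not_blue_edge(1)[OF that(2)] k n
    by simp
  have "num_colorings verts
      (\<lambda>B. P n \<subseteq> B \<and> v 0 \<notin> B \<and> v (n - 1) \<notin> B \<and> \<not> blue_subpath k 0 (n - 1) B) j =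
    num_colorings verts
      (\<lambda>B. P n \<subseteq> B \<and> B \<inter> {v 0, v (n - 1)} = {} \<and> \<not> blue_subpath k 1 (n - 3) B) j"
    using eq by (intro num_colorings_cong refl) auto
  also have "\<dots> = (\<Sum>i=0..card (P 1 \<union> P (n - 1)). (card (P 1 \<union> P (n - 1)) choose i) *
      num_colorings (seg 1 (n - 3)) (\<lambda>B. \<not> blue_subpath k 1 (n - 3) B) (j - int (card (P n)) - int i))"
    using n
    by (intro num_colorings_split verts_split_both finite_seg finite_P_Un)
      (auto simp: blue_subpath_Int P_fin v_P Int_Un_distrib Int_Un_distrib2 P_disj P_seg v_notin_seg)
  also have "\<dots> = (\<Sum>i=0..2 * r - 4. (2 * r - 4 choose i) * F_count k (n - 3) W D (j - int i - (int r - 2)))"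
    using seg_count[OF W] n r by (simp add: card_P_Un P_card of_nat_diff algebra_simps)
  finally show ?thesis .
qed

text \<open>The red end \<open>v (n - 1)\<close> removes edge \<open>n - 1\<close> and frees
  \<open>P (n - 1)\<close>. The remaining path starts with a blue edge and is classified by its
  initial blue stretch; \<open>n > k + 2\<close> ensures that it has at least \<open>k\<close>
  edges.\<close>

lemma count_first_edge_blue:
  assumes k: "k \<ge> 1" and n: "n = q + 3" "n > k + 2" and W: "loose_path_labelling r (n - 2) W D"
  shows "num_colorings verts
      (\<lambda>B. P n \<subseteq> B \<and> v (n - 1) \<notin> B \<and> blue B (edge 1) \<and> \<not> blue_subpath k 0 (n - 1) B) j =
    (\<Sum>l=1..k - 1. \<Sum>i=0..r - 2. (r - 2 choose i) *
      F_init_count k l (n - 2) W D (j - (int r - 2) - int i))"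
proof -
  have eq: "blue_subpath k 0 (n - 1) B = blue_subpath k 0 (n - 2) B" if "v (n - 1) \<notin> B" for B
    using blue_subpath_drop_last[of B 0 "Suc q" k] not_blue_edge(1)[OF that] k n
    by simp
  have first: "blue (B \<inter> seg 0 (n - 2)) (edge 1) = blue B (edge 1)" for B
    using edge_subset_seg[of 1 "n - 2" 0] n by (auto simp: blue_def)
  have init: "num_colorings (seg 0 (n - 2)) (\<lambda>B. blue B (edge 1) \<and> \<not> blue_subpath k 0 (n - 2) B) j' =
      (\<Sum>l=1..k - 1. F_init_count k l (n - 2) W D j')" for j'
    using num_colorings_first_blue[of "seg 0 (n - 2)" k "n - 2" j' edge]
      F_init_count_eq[OF seg_labelling[of 0 "n - 2"] W] finite_seg[of 0 "n - 2"] k n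
    by (simp add: blue_subpath_def)
  have "num_colorings verts
      (\<lambda>B. P n \<subseteq> B \<and> v (n - 1) \<notin> B \<and> blue B (edge 1) \<and> \<not> blue_subpath k 0 (n - 1) B) j =
    num_colorings verts
      (\<lambda>B. P n \<subseteq> B \<and> B \<inter> {v (n - 1)} = {} \<and> (blue B (edge 1) \<and> \<not> blue_subpath k 0 (n - 2) B)) j"
    using eq by (intro num_colorings_cong refl) auto
  also have "\<dots> = (\<Sum>i=0..card (P (n - 1)). (card (P (n - 1)) choose i) *
      num_colorings (seg 0 (n - 2)) (\<lambda>B. blue B (edge 1) \<and> \<not> blue_subpath k 0 (n - 2) B)
        (j - int (card (P n)) - int i))"
    using n first
    by (intro num_colorings_split verts_split_last finite_seg P_fin)
      (auto simp: blue_subpath_Int v_P P_disj P_seg v_notin_seg)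
  also have "\<dots> = (\<Sum>i=0..r - 2. \<Sum>l=1..k - 1. (r - 2 choose i) *
      F_init_count k l (n - 2) W D (j - (int r - 2) - int i))"
    unfolding init using n r by (simp add: P_card of_nat_diff sum_distrib_left)
  \<comment> \<open>The splitting puts the sum over the free vertices outside; the statement has the
    sum over \<open>l\<close> outside.\<close>
  finally show ?thesis by (subst sum.swap)
qed

text \<open>A red vertex of \<open>P 1\<close> removes edge \<open>1\<close>, and
  \<open>v (n - 1)\<close> removes edge \<open>n - 1\<close>. Two splittings are nested:
  \<open>b\<close> counts the blue vertices of the incomplete block \<open>P 1\<close>,
  \<open>a\<close> those of the free block \<open>P (n - 1)\<close>. The extra \<open>1\<close> is
  the blue \<open>v 0\<close>.\<close>

lemma count_first_private_not_blue:
  assumes k: "k \<ge> 1" and n: "n = q + 3" and W: "loose_path_labelling r (n - 3) W D"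
  shows "num_colorings verts
      (\<lambda>B. P n \<subseteq> B \<and> v 0 \<in> B \<and> v (n - 1) \<notin> B \<and> \<not> P 1 \<subseteq> B \<and> \<not> blue_subpath k 0 (n - 1) B) j =
    (\<Sum>b=0..r - 3. \<Sum>a=0..r - 2. (r - 2 choose a) * (r - 2 choose b) *
      F_count k (n - 3) W D (j - (int r - 2) - 1 - (int a + int b)))"
proof -
  let ?T = "P n \<union> {v 0}" and ?R = "{v (n - 1)}" and ?X = "P (n - 1)" and ?Y = "seg 1 (n - 3)"
  let ?U = "?T \<union> ?R \<union> ?X \<union> ?Y"
  let ?Q = "\<lambda>B. ?T \<subseteq> B \<and> B \<inter> ?R = {} \<and> \<not> blue_subpath k 1 (n - 3) B"
  have eq: "blue_subpath k 0 (n - 1) B = blue_subpath k 1 (n - 3) B"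
    if "\<not> P 1 \<subseteq> B" "v (n - 1) \<notin> B" for B
  proof -
    have "\<not> blue B (edge (Suc 0))" using that(1) by (auto simp: blue_def edge_def)
    from blue_subpath_drop_first[OF this k, of "Suc q"] show ?thesis
      using blue_subpath_drop_last[of B 1 q k] not_blue_edge(1)[OF that(2)] k n
      by simp
  qed
  have fin: "finite ?U" using n by (auto simp: P_fin finite_seg)
  have disj: "P 1 \<inter> ?U = {}"
    using n by (auto simp: v_P Int_Un_distrib Int_Un_distrib2 P_disj P_seg)
  have c: "card (P 1) = r - 2" "card ?X = r - 2" "card ?T = r - 1"
    using n r v_P[of 0 n] by (auto simp: P_card P_fin)
  then have "P 1 \<noteq> {}" using r by (intro notI) simp
  have V: "verts = P 1 \<union> ?U" unfolding verts_split_both[OF n] by auto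
  have "num_colorings verts
      (\<lambda>B. P n \<subseteq> B \<and> v 0 \<in> B \<and> v (n - 1) \<notin> B \<and> \<not> P 1 \<subseteq> B \<and> \<not> blue_subpath k 0 (n - 1) B) j =
    num_colorings (P 1 \<union> ?U) (\<lambda>B. \<not> P 1 \<subseteq> B \<and> ?Q B) j"
    using eq by (intro num_colorings_cong V refl) auto
  also have "\<dots> = (\<Sum>b=0..card (P 1) - 1. (card (P 1) choose b) * num_colorings ?U ?Q (j - int b))"
  proof (intro num_colorings_split_proper)
    fix B
    have "blue_subpath k 1 (n - 3) (B \<inter> ?U) = blue_subpath k 1 (n - 3) B"
      by (intro blue_subpath_Int) auto
    then show "?Q (B \<inter> ?U) = ?Q B" by auto
  qed (use n fin disj \<open>P 1 \<noteq> {}\<close> in \<open>auto simp: P_fin\<close>)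
  also have "\<dots> = (\<Sum>b=0..card (P 1) - 1. (card (P 1) choose b) * (\<Sum>a=0..card ?X. (card ?X choose a) *
      num_colorings ?Y (\<lambda>B. \<not> blue_subpath k 1 (n - 3) B) (j - int b - int (card ?T) - int a)))"
  proof (intro sum.cong refl arg_cong2[where f = "(*)"] num_colorings_split)
    show "?T \<inter> ?R = {}" using n v_P[of "n - 1" n] v_eq[of 0 "n - 1"] by auto
    show "?T \<inter> ?X = {}" using n v_P[of 0 "n - 1"] P_disj[of n "n - 1"] by auto
    show "?T \<inter> ?Y = {}" using n v_notin_seg[of 0 1 "n - 3"] P_seg[of n 1 "n - 3"] by auto
    show "?R \<inter> ?X = {}" using n v_P[of "n - 1" "n - 1"] by auto
    show "?R \<inter> ?Y = {}" using n v_notin_seg[of "n - 1" 1 "n - 3"] by auto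
    show "?X \<inter> ?Y = {}" using n P_seg[of "n - 1" 1 "n - 3"] by auto
  qed (use n in \<open>auto simp: P_fin finite_seg blue_subpath_Int\<close>)
  also have "\<dots> = (\<Sum>b=0..r - 3. \<Sum>a=0..r - 2. (r - 2 choose a) * (r - 2 choose b) *
      F_count k (n - 3) W D (j - (int r - 2) - 1 - (int a + int b)))"
    unfolding c using seg_count[OF W, of 1] n r
    by (simp add: of_nat_diff sum_distrib_left algebra_simps numeral_3_eq_3)
  finally show ?thesis .
qed

text \<open>The red \<open>v 1\<close> lies in both edge \<open>1\<close> and edge \<open>2\<close>,
  so three edges disappear together with edge \<open>n - 1\<close>. Forced blue are
  \<open>P n\<close>, \<open>P 1\<close> and \<open>v 0\<close>; free are \<open>P 2\<close> and
  \<open>P (n - 1)\<close>.\<close>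

lemma count_second_red:
  assumes k: "k \<ge> 1" and n: "n = q + 4" and W: "loose_path_labelling r (n - 4) W D"
  shows "num_colorings verts
      (\<lambda>B. P n \<subseteq> B \<and> v 0 \<in> B \<and> v (n - 1) \<notin> B \<and> P 1 \<subseteq> B \<and> v 1 \<notin> B \<and> \<not> blue_subpath k 0 (n - 1) B) j =
    (\<Sum>i=0..2 * r - 4. (2 * r - 4 choose i) * F_count k (n - 4) W D (j - 2 * (int r - 2) - 1 - int i))"
proof -
  let ?T = "P n \<union> {v 0} \<union> P 1" and ?R = "{v (n - 1), v 1}" and ?X = "P (n - 1) \<union> P 2"
    and ?Y = "seg 2 (n - 4)"
  have eq: "blue_subpath k 0 (n - 1) B = blue_subpath k 2 (n - 4) B"
    if "v (n - 1) \<notin> B" "v 1 \<notin> B" for B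
  proof -
    have "blue_subpath k 0 (Suc (Suc (Suc q))) B = blue_subpath k (Suc 0) (Suc (Suc q)) B"
      using not_blue_edge(1)[OF that(2)] k by (intro blue_subpath_drop_first) simp_all
    also have "\<dots> = blue_subpath k (Suc (Suc 0)) (Suc q) B"
      using not_blue_edge(2)[OF that(2)] k by (intro blue_subpath_drop_first) simp_all
    also have "\<dots> = blue_subpath k (Suc (Suc 0)) q B"
    proof (intro blue_subpath_drop_last k)
      have "Suc (Suc 0) + Suc q = n - 1" using n by simp
      then show "\<not> blue B (edge (Suc (Suc 0) + Suc q))" using not_blue_edge(1)[OF that(1)] by simp
    qed
    moreover have "Suc (Suc (Suc q)) = n - 1" "Suc (Suc 0) = 2" "q = n - 4" using n by simp_all
    ultimately show ?thesis by metis
  qed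
  have c: "card ?X = 2 * r - 4" "card ?T = 2 * r - 3"
    using n r card_P_Un[of "n - 1" 2] card_P_Un[of n 1] v_P[of 0 n] v_P[of 0 1]
    by (auto simp: P_fin Un_commute)
  have "num_colorings verts
      (\<lambda>B. P n \<subseteq> B \<and> v 0 \<in> B \<and> v (n - 1) \<notin> B \<and> P 1 \<subseteq> B \<and> v 1 \<notin> B \<and> \<not> blue_subpath k 0 (n - 1) B) j =
    num_colorings verts (\<lambda>B. ?T \<subseteq> B \<and> B \<inter> ?R = {} \<and> \<not> blue_subpath k 2 (n - 4) B) j"
    using eq by (intro num_colorings_cong refl) auto
  also have "\<dots> = (\<Sum>i=0..card ?X. (card ?X choose i) *
      num_colorings ?Y (\<lambda>B. \<not> blue_subpath k 2 (n - 4) B) (j - int (card ?T) - int i))"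
  proof (intro num_colorings_split verts_split_both2 n)
    show "?T \<inter> ?R = {}"
      using n v_P[of "n - 1" n] v_P[of "n - 1" 1] v_P[of 1 n] v_P[of 1 1] v_eq[of 0 "n - 1"] v_eq[of 0 1]
      by auto
    show "?T \<inter> ?X = {}"
      using n v_P[of 0 "n - 1"] v_P[of 0 2] P_disj[of n "n - 1"] P_disj[of n 2]
        P_disj[of 1 "n - 1"] P_disj[of 1 2] by auto
    show "?T \<inter> ?Y = {}"
      using n v_notin_seg[of 0 2 "n - 4"] P_seg[of n 2 "n - 4"] P_seg[of 1 2 "n - 4"] by auto
    show "?R \<inter> ?X = {}"
      using n v_P[of "n - 1" "n - 1"] v_P[of "n - 1" 2] v_P[of 1 "n - 1"] v_P[of 1 2] by auto
    show "?R \<inter> ?Y = {}" using n v_notin_seg[of "n - 1" 2 "n - 4"] v_notin_seg[of 1 2 "n - 4"] by auto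
    show "?X \<inter> ?Y = {}" using n P_seg[of "n - 1" 2 "n - 4"] P_seg[of 2 2 "n - 4"] by auto
  qed (use n in \<open>auto simp: P_fin finite_seg blue_subpath_Int\<close>)
  also have "\<dots> = (\<Sum>i=0..2 * r - 4. (2 * r - 4 choose i) *
      F_count k (n - 4) W D (j - 2 * (int r - 2) - 1 - int i))"
    unfolding c using seg_count[OF W, of 2] n r by (simp add: of_nat_diff algebra_simps)
  finally show ?thesis .
qed

lemma finite_verts: "n \<ge> 1 \<Longrightarrow> finite verts"
  by (simp add: verts_def P_fin finite_seg)

lemma count_one_red:
  assumes k: "k \<ge> 1" "n > k + 2"
    and W: "\<And>m. loose_path_labelling r m (W m) (D m)"
  shows "num_colorings verts
      (\<lambda>B. P n \<subseteq> B \<and> v 0 \<in> B \<and> v (n - 1) \<notin> B \<and> \<not> blue_subpath k 0 (n - 1) B) j =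
    (\<Sum>l=1..k - 1. \<Sum>i=0..r - 2. (r - 2 choose i) *
      F_init_count k l (n - 2) (W (n - 2)) (D (n - 2)) (j - (int r - 2) - int i)) +
    (\<Sum>b=0..r - 3. \<Sum>a=0..r - 2. (r - 2 choose a) * (r - 2 choose b) *
      F_count k (n - 3) (W (n - 3)) (D (n - 3)) (j - (int r - 2) - 1 - (int a + int b))) +
    (\<Sum>i=0..2 * r - 4. (2 * r - 4 choose i) *
      F_count k (n - 4) (W (n - 4)) (D (n - 4)) (j - 2 * (int r - 2) - 1 - int i))"
    (is "?lhs = _")
proof -
  \<comment> \<open>The condition \<open>v 0 \<in> B\<close> is omitted here because it follows from
    edge \<open>1\<close> being blue.\<close>
  let ?A = "\<lambda>B. P n \<subseteq> B \<and> v (n - 1) \<notin> B \<and> blue B (edge 1) \<and> \<not> blue_subpath k 0 (n - 1) B"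
  let ?B = "\<lambda>B. P n \<subseteq> B \<and> v 0 \<in> B \<and> v (n - 1) \<notin> B \<and> \<not> P 1 \<subseteq> B \<and> \<not> blue_subpath k 0 (n - 1) B"
  let ?C = "\<lambda>B. P n \<subseteq> B \<and> v 0 \<in> B \<and> v (n - 1) \<notin> B \<and> P 1 \<subseteq> B \<and> v 1 \<notin> B \<and> \<not> blue_subpath k 0 (n - 1) B"
  \<comment> \<open>Since \<open>k \<ge> 1\<close>, the bound \<open>n > k + 2\<close> gives
    \<open>n \<ge> 4\<close>, so that edges \<open>1\<close>, \<open>2\<close> and
    \<open>n - 1\<close> are distinct.\<close>
  obtain q where n: "n = q + 4" using k by (intro that[of "n - 4"]) auto
  have e: "blue B (edge (Suc 0)) \<longleftrightarrow> v 0 \<in> B \<and> v (Suc 0) \<in> B \<and> P (Suc 0) \<subseteq> B" for B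
    by (auto simp: blue_def edge_def)
  note fin = finite_colorings[OF finite_verts]
  have "?lhs = card ({B \<in> colorings verts j. ?A B} \<union> {B \<in> colorings verts j. ?B B} \<union> {B \<in> colorings verts j. ?C B})"
    by (intro arg_cong[of _ _ card]) (auto simp: e)
  also have "\<dots> = card ({B \<in> colorings verts j. ?A B} \<union> {B \<in> colorings verts j. ?B B}) + num_colorings verts ?C j"
    using n by (intro card_Un_disjoint finite_UnI fin) (auto simp: e)
  also have "\<dots> = num_colorings verts ?A j + num_colorings verts ?B j + num_colorings verts ?C j"
    using n by (subst card_Un_disjoint[OF fin fin]) (auto simp: e)
  finally show ?thesis
    using count_first_edge_blue[OF k(1) _ k(2) W, of "q + 1" j]
      count_first_private_not_blue[OF k(1) _ W, of "q + 1" j]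
      count_second_red[OF k(1) n W, of j] n by simp
qed

section \<open>Mirror symmetry of the cycle about edge \<open>n\<close>\<close>

lemma reflect: "cycle_coords r n (\<lambda>i. v (n - 1 - i)) (\<lambda>i. if i = n then P n else P (n - i))"
proof
  show "inj_on (\<lambda>i. v (n - 1 - i)) {..<n}" by (rule inj_onI) (auto simp: v_eq)
  fix i j
  show "v (n - 1 - i) \<notin> (if j = n then P n else P (n - j))" if "i < n" "j \<in> {1..n}"
  proof (cases "j = n")
    case False
    then have "n - j \<in> {1..n}" using that by auto
    then show ?thesis using v_P[of "n - 1 - i" "n - j"] that False by simp
  qed (use v_P[of "n - 1 - i" n] that in simp)
  show "(if i = n then P n else P (n - i)) \<inter> (if j = n then P n else P (n - j)) = {}"
    if "i \<in> {1..n}" "j \<in> {1..n}" "i \<noteq> j"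
  proof -
    \<comment> \<open>The index \<open>n\<close> is kept fixed because \<open>n - n = 0\<close> is
      no edge index; the other indices are reflected to \<open>n - i\<close>.\<close>
    define i' where "i' = (if i = n then n else n - i)"
    define j' where "j' = (if j = n then n else n - j)"
    have "i' \<in> {1..n}" "j' \<in> {1..n}" "i' \<noteq> j'" using that by (auto simp: i'_def j'_def)
    from P_disj[OF this] show ?thesis by (simp add: i'_def j'_def split: if_splits)
  qed
qed (auto simp: r P_fin P_card)

text \<open>The formula of \<open>count_one_red\<close> does not mention \<open>v\<close> or
  \<open>P\<close>. Applied in the reflected coordinates, where the two ends are exchanged, it
  therefore gives the same value.\<close>

lemma count_other_red:
  assumes k: "k \<ge> 1" "n > k + 2"
    and W: "\<And>m. loose_path_labelling r m (W m) (D m)"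
  shows "num_colorings verts
      (\<lambda>B. P n \<subseteq> B \<and> v 0 \<notin> B \<and> v (n - 1) \<in> B \<and> \<not> blue_subpath k 0 (n - 1) B) j =
    num_colorings verts
      (\<lambda>B. P n \<subseteq> B \<and> v 0 \<in> B \<and> v (n - 1) \<notin> B \<and> \<not> blue_subpath k 0 (n - 1) B) j"
proof -
  interpret R: cycle_coords r n "\<lambda>i. v (n - 1 - i)" "\<lambda>i. if i = n then P n else P (n - i)"
    by (rule reflect)
  have refl_image: "(\<lambda>i. n - 1 - i) ` {0..n - 1} = {0..n - 1}" "(\<lambda>i. n - i) ` {0<..n - 1} = {0<..n - 1}"
  proof -
    have "i \<in> (\<lambda>i. n - 1 - i) ` {0..n - 1}" if "i \<in> {0..n - 1}" for i
      using that by (intro image_eqI[of _ _ "n - 1 - i"]) auto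
    then show "(\<lambda>i. n - 1 - i) ` {0..n - 1} = {0..n - 1}" by auto
    have "i \<in> (\<lambda>i. n - i) ` {0<..n - 1}" if "i \<in> {0<..n - 1}" for i
      using that by (intro image_eqI[of _ _ "n - i"]) auto
    then show "(\<lambda>i. n - i) ` {0<..n - 1} = {0<..n - 1}" by auto
  qed
  have "R.seg 0 (n - 1) = v ` (\<lambda>i. n - 1 - i) ` {0..n - 1} \<union> \<Union> (P ` (\<lambda>i. n - i) ` {0<..n - 1})"
    unfolding R.seg_def image_image by (intro arg_cong2[where f = "(\<union>)"] SUP_cong) auto
  also have "\<dots> = seg 0 (n - 1)" unfolding refl_image by (simp add: seg_def)
  finally have verts: "R.verts = verts" unfolding verts_def R.verts_def by simp
  have edge: "R.edge i = edge (n - i)" if "i \<in> {1..n - 1}" for i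
  proof -
    have "n - 1 - (i - 1) = n - i" "n - 1 - i = n - i - 1" "i \<noteq> n" using that by auto
    then show ?thesis unfolding R.edge_def edge_def by (simp add: insert_commute)
  qed
  have sub: "R.blue_subpath k 0 (n - 1) B = blue_subpath k 0 (n - 1) B" for B
  proof -
    \<comment> \<open>Reflected coordinates list the edges \<open>1\<close> to \<open>n - 1\<close>
      backwards, which leaves the existence of a blue subpath unchanged.\<close>
    have "R.blue_subpath k 0 (n - 1) B = path_blue_subpath k (n - 1) (\<lambda>i. edge (Suc (n - 1) - i)) B"
      unfolding R.blue_subpath_def
    proof (intro path_blue_subpath_cong)
      fix i assume i: "i \<in> {1..n - 1}"
      then have "Suc (n - 1) - i = n - i" by auto
      then show "blue B (R.edge (0 + i)) = blue B (edge (Suc (n - 1) - i))" using edge[OF i] by simp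
    qed
    then show ?thesis unfolding path_blue_subpath_reverse by (simp add: blue_subpath_def)
  qed
  \<comment> \<open>The conditions are put into the order of \<open>count_one_red\<close>, with
    \<open>v (n - 1)\<close> as the reflected \<open>v 0\<close>.\<close>
  have swap: "num_colorings verts
      (\<lambda>B. P n \<subseteq> B \<and> v 0 \<notin> B \<and> v (n - 1) \<in> B \<and> \<not> blue_subpath k 0 (n - 1) B) j =
    num_colorings verts
      (\<lambda>B. P n \<subseteq> B \<and> v (n - 1) \<in> B \<and> v 0 \<notin> B \<and> \<not> blue_subpath k 0 (n - 1) B) j"
    by (intro num_colorings_cong) auto
  show ?thesis
    using R.count_one_red[OF k W, of j] unfolding swap count_one_red[OF k W, of j] verts sub by simp
qed

text \<open>Once \<open>P n\<close> is blue, edge \<open>n\<close> is non-blue exactly when an end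
  is red, so the four cases are disjoint and exhaustive.\<close>

lemma count_last_not_blue:
  assumes "n \<ge> 1"
  shows "num_colorings verts
      (\<lambda>B. \<not> insert (v 0) (insert (v (n - 1)) (P n)) \<subseteq> B \<and> \<not> blue_subpath k 0 (n - 1) B) j =
    num_colorings verts (\<lambda>B. \<not> P n \<subseteq> B \<and> \<not> blue_subpath k 0 (n - 1) B) j +
    num_colorings verts
      (\<lambda>B. P n \<subseteq> B \<and> v 0 \<notin> B \<and> v (n - 1) \<notin> B \<and> \<not> blue_subpath k 0 (n - 1) B) j +
    num_colorings verts
      (\<lambda>B. P n \<subseteq> B \<and> v 0 \<in> B \<and> v (n - 1) \<notin> B \<and> \<not> blue_subpath k 0 (n - 1) B) j +
    num_colorings verts
      (\<lambda>B. P n \<subseteq> B \<and> v 0 \<notin> B \<and> v (n - 1) \<in> B \<and> \<not> blue_subpath k 0 (n - 1) B) j"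
    (is "num_colorings verts ?Q j = num_colorings verts ?A j + num_colorings verts ?B j +
      num_colorings verts ?C j + num_colorings verts ?D j")
proof -
  let ?S = "\<lambda>Q. {B \<in> colorings verts j. Q B}"
  note fin = finite_colorings[OF finite_verts[OF assms]]
  have "?S ?Q = ?S ?A \<union> ?S ?B \<union> ?S ?C \<union> ?S ?D" by blast
  moreover have "card (?S ?A \<union> ?S ?B \<union> ?S ?C \<union> ?S ?D) = card (?S ?A \<union> ?S ?B \<union> ?S ?C) + card (?S ?D)"
    by (intro card_Un_disjoint finite_UnI fin) blast
  moreover have "card (?S ?A \<union> ?S ?B \<union> ?S ?C) = card (?S ?A \<union> ?S ?B) + card (?S ?C)"
    by (intro card_Un_disjoint finite_UnI fin) blast
  moreover have "card (?S ?A \<union> ?S ?B) = card (?S ?A) + card (?S ?B)"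
    by (intro card_Un_disjoint fin) blast
  ultimately show ?thesis by presburger
qed

end

section \<open>From labelled loose cycles to coordinates\<close>

text \<open>The vertex shared by cyclically consecutive edges has degree 2, and these vertices are
  distinct. Hence the two vertices of degree 2 in an edge are those shared with its neighbours, and
  the other \<open>r - 2\<close> form \<open>P i\<close>.\<close>

lemma loose_cycle_coords:
  assumes cyc: "loose_cycle_labelling r n V E" and n: "n \<ge> 3" and r: "r > 2"
  obtains v P where "cycle_coords r n v P"
    and "\<And>i. i \<in> {1..<n} \<Longrightarrow> E i = cycle_coords.edge v P i"
    and "E n = insert (v 0) (insert (v (n - 1)) (P n))"
    and "V = cycle_coords.verts n v P"
proof -
  let ?\<E> = "E ` {1..n}"
  define nx where "nx i = (if i = n then 1 else Suc i)" for i
  define pr where "pr i = (if i = 1 then n else i - 1)" for i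
  have inj: "inj_on E {1..n}" and V: "V = \<Union> ?\<E>" and fV: "finite V"
    and c: "\<And>i. i \<in> {1..n} \<Longrightarrow> card (E i) = r"
    and d2: "\<And>i. i \<in> {1..n} \<Longrightarrow> card {x \<in> E i. degree ?\<E> x = 2} = 2"
    and d12: "\<And>i x. i \<in> {1..n} \<Longrightarrow> x \<in> E i \<Longrightarrow> degree ?\<E> x = 1 \<or> degree ?\<E> x = 2"
    and meet: "\<And>i. i \<in> {1..n} \<Longrightarrow> card (E i \<inter> E (i mod n + 1)) = 1"
    using cyc unfolding loose_cycle_labelling_def loose_cycle_def uniform_hypergraph_def by blast+
  have nx: "i mod n + 1 = nx i" "nx i \<in> {1..n}" "nx i \<noteq> i" "nx (nx i) \<noteq> i" "pr i \<in> {1..n}"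
    "nx (pr i) = i" "pr i \<noteq> i" if "i \<in> {1..n}" for i
    using that n by (auto simp: nx_def pr_def split: if_splits)
  have "\<exists>x. E i \<inter> E (nx i) = {x}" if "i \<in> {1..n}" for i
    using meet[OF that] nx(1)[OF that] by (auto simp: card_1_singleton_iff)
  then obtain s where "\<And>i. i \<in> {1..n} \<Longrightarrow> E i \<inter> E (nx i) = {s i}" by metis
  then have s: "s i \<in> E i" "s i \<in> E (nx i)" if "i \<in> {1..n}" for i using that by blast+
  \<comment> \<open>Distinct indices give distinct edges, so the number of indices whose edges
    contain \<open>x\<close> bounds its degree from below.\<close>
  have card_le: "card I \<le> degree ?\<E> x" if "I \<subseteq> {1..n}" "\<forall>i\<in>I. x \<in> E i" for I x
  proof -
    have "card I = card (E ` I)" using inj that by (metis card_image inj_on_subset)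
    also have "\<dots> \<le> card {e \<in> ?\<E>. x \<in> e}" using that by (intro card_mono) auto
    finally show ?thesis by (simp add: degree_def)
  qed
  have deg_s: "degree ?\<E> (s i) = 2" if i: "i \<in> {1..n}" for i
    using card_le[of "{i, nx i}" "s i"] d12[OF i s(1)[OF i]] s[OF i] nx[OF i] i by auto
  have s_inj: "i = j" if "s i = s j" "i \<in> {1..n}" "j \<in> {1..n}" for i j
  proof (rule ccontr)
    assume "i \<noteq> j"
    \<comment> \<open>A common vertex would lie in the edges \<open>i\<close>, \<open>nx i\<close>,
      \<open>j\<close> and \<open>nx j\<close>. Degree 2 forces \<open>j = nx i\<close>, and then
      \<open>nx j\<close> can be neither \<open>i\<close> nor \<open>nx i\<close>.\<close>
    have "card {i, nx i, j} \<le> 2" "card {i, nx i, nx j} \<le> 2"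
      using card_le[of "{i, nx i, j}" "s i"] card_le[of "{i, nx i, nx j}" "s i"] deg_s[OF that(2)]
        s[OF that(2)] s[OF that(3)] that nx by auto
    then have "j = nx i" "nx j = i \<or> nx j = nx i"
      using \<open>i \<noteq> j\<close> nx(3)[OF that(2)] by (auto simp: card_insert_if split: if_splits)
    then show False using nx(3)[OF that(3)] nx(4)[OF that(2)] by metis
  qed
  have D: "{x \<in> E i. degree ?\<E> x = 2} = {s (pr i), s i}" if i: "i \<in> {1..n}" for i
  proof (rule card_subset_eq[symmetric])
    have "E i \<subseteq> V" using i V by blast
    then show "finite {x \<in> E i. degree ?\<E> x = 2}" using fV by (auto intro: finite_subset)
    have "s (pr i) \<in> E i" using s(2)[OF nx(5)[OF i]] nx(6)[OF i] by simp
    then show "{s (pr i), s i} \<subseteq> {x \<in> E i. degree ?\<E> x = 2}"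
      using s(1)[OF i] deg_s[OF i] deg_s[OF nx(5)[OF i]] by simp
    have "s (pr i) \<noteq> s i" using s_inj[OF _ nx(5)[OF i] i] nx(7)[OF i] by blast
    then show "card {s (pr i), s i} = card {x \<in> E i. degree ?\<E> x = 2}" using d2[OF i] by simp
  qed
  define P where "P i = {x \<in> E i. degree ?\<E> x = 1}" for i
  \<comment> \<open>Index \<open>0\<close> stands for the vertex shared by edges \<open>n\<close>
    and \<open>1\<close>, so that edge \<open>i\<close> contains \<open>v (i - 1)\<close> also for
    \<open>i = 1\<close>.\<close>
  define v where "v i = (if i = 0 then s n else s i)" for i
  have E: "E i = {s (pr i), s i} \<union> P i" if i: "i \<in> {1..n}" for i
    using d12[OF i] unfolding D[OF i, symmetric] P_def by auto
  have finE: "finite (E i)" if "i \<in> {1..n}" for i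
    using that fV V by (auto intro: finite_subset)
  have "card (P i) = r - 2" if i: "i \<in> {1..n}" for i
  proof -
    have "P i = E i - {x \<in> E i. degree ?\<E> x = 2}" using d12[OF i] by (auto simp: P_def)
    then show ?thesis using c[OF i] d2[OF i] finE[OF i] by (simp add: card_Diff_subset)
  qed
  moreover have "P i \<inter> P j = {}" if "i \<in> {1..n}" "j \<in> {1..n}" "i \<noteq> j" for i j
  proof -
    have "degree ?\<E> x \<noteq> 1" if "x \<in> E i" "x \<in> E j" for x
      using card_le[of "{i, j}" x] that \<open>i \<in> {1..n}\<close> \<open>j \<in> {1..n}\<close> \<open>i \<noteq> j\<close> by auto
    then show ?thesis by (auto simp: P_def)
  qed
  moreover have v_s: "\<exists>l\<in>{1..n}. v i = s l" if "i < n" for i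
    using that n by (auto simp: v_def intro!: bexI[of _ "if i = 0 then n else i"])
  then have "v i \<notin> P j" if "i < n" for i j using that deg_s by (fastforce simp: P_def)
  moreover have "inj_on v {..<n}"
  proof (rule inj_onI)
    fix i j assume "i \<in> {..<n}" "j \<in> {..<n}" "v i = v j"
    then have "(if i = 0 then n else i) = (if j = 0 then n else j)"
      by (intro s_inj) (auto simp: v_def split: if_splits)
    then show "i = j" using \<open>i \<in> {..<n}\<close> \<open>j \<in> {..<n}\<close> by (auto split: if_splits)
  qed
  ultimately have C: "cycle_coords r n v P"
    using r finE by unfold_locales (auto simp: P_def)
  interpret cycle_coords r n v P by (rule C)
  have edge: "E i = edge i" if "i \<in> {1..<n}" for i
    using E[of i] that by (auto simp: edge_def v_def pr_def)
  moreover have last: "E n = insert (v 0) (insert (v (n - 1)) (P n))"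
    using E[of n] n by (auto simp: v_def pr_def)
  moreover have "V = verts"
  proof -
    have "{1..n} = insert n {1..<n}" using n by auto
    then have "V = E n \<union> \<Union> (edge ` {1..<n})" using V edge by auto
    also have "\<Union> (edge ` {1..<n}) = seg 0 (n - 1)"
    proof -
      have "{1..<n} = {1..n - 1}" using n by auto
      then show ?thesis
        using seg_labelling[of 0 "n - 1"] n by (simp add: loose_path_labelling_def)
    qed
    also have "E n \<union> seg 0 (n - 1) = verts" using last by (auto simp: verts_def seg_def)
    finally show ?thesis .
  qed
  ultimately show thesis using that C by blast
qed

theorem theorem4p10:
  fixes k n r M N j :: nat
    and V :: "'a set" and E :: "nat \<Rightarrow> 'a set"
    and W :: "nat \<Rightarrow> 'b set" and D :: "nat \<Rightarrow> nat \<Rightarrow> 'b set"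
  assumes "k \<ge> 1" and "n > k + 2" and "r > 2"
    and "M = n * (r - 1) + 1"
    and "N = (k - 1) * (r - 1) + 2 * (r - 2) + 1"
    and "j < (M div N) * (N - 1) + N mod M"
    and cycle: "loose_cycle_labelling r n V E"
    and paths: "\<And>m. loose_path_labelling r m (W m) (D m)"
  shows "C_nb_count k n V E (int j) =
      (\<Sum>i=0..r - 3. (r - 2 choose i) *
         F_count k (n - 1) (W (n - 1)) (D (n - 1)) (int j - int i))
    + (\<Sum>i=0..2 * r - 4. (2 * r - 4 choose i) *
         F_count k (n - 3) (W (n - 3)) (D (n - 3)) (int j - int i - (int r - 2)))
    + 2 * (\<Sum>l=1..k - 1. \<Sum>i=0..r - 2. (r - 2 choose i) *
         F_init_count k l (n - 2) (W (n - 2)) (D (n - 2)) (int j - (int r - 2) - int i))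
    + 2 * (\<Sum>b=0..r - 3. \<Sum>a=0..r - 2. (r - 2 choose a) * (r - 2 choose b) *
         F_count k (n - 3) (W (n - 3)) (D (n - 3))
           (int j - (int r - 2) - 1 - (int a + int b)))
    + 2 * (\<Sum>i=0..2 * r - 4. (2 * r - 4 choose i) *
         F_count k (n - 4) (W (n - 4)) (D (n - 4)) (int j - 2 * (int r - 2) - 1 - int i))"
proof -
  have n3: "n \<ge> 3" using assms by simp
  obtain v P where "cycle_coords r n v P"
    and E: "\<And>i. i \<in> {1..<n} \<Longrightarrow> E i = cycle_coords.edge v P i"
    and last: "E n = insert (v 0) (insert (v (n - 1)) (P n))"
    and V: "V = cycle_coords.verts n v P"
    using loose_cycle_coords[OF cycle n3 \<open>r > 2\<close>] by blast
  interpret cycle_coords r n v P by fact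
  have "path_blue_subpath k (n - 1) E B = blue_subpath k 0 (n - 1) B" for B
    unfolding blue_subpath_def using E by (intro path_blue_subpath_cong) auto
  then have "cycle_blue_subpath k n E B = blue_subpath k 0 (n - 1) B" if "\<not> blue B (E n)" for B
    using cycle_blue_subpath_nonblue_last[of k n B E] that assms(1,2) by simp
  then have "C_nb_count k n V E (int j) = num_colorings verts
      (\<lambda>B. \<not> insert (v 0) (insert (v (n - 1)) (P n)) \<subseteq> B \<and> \<not> blue_subpath k 0 (n - 1) B) (int j)"
    unfolding C_nb_count_def V by (intro num_colorings_cong refl) (auto simp: blue_def last)
  \<comment> \<open>The second fact supplies the form \<open>q + 3\<close> expected by
    \<open>count_both_red\<close>, with \<open>q = n - 3\<close>.\<close>
  moreover have n1: "n \<ge> 1" and n3': "n = n - 3 + 3" using n3 by simp_all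
  \<comment> \<open>Both cases with exactly one red end are rewritten to the same three sums, which
    yields the factors \<open>2\<close>.\<close>
  ultimately show ?thesis
    unfolding count_last_not_blue[OF n1] count_private_not_blue[OF n1 paths]
      count_both_red[OF \<open>k \<ge> 1\<close> n3' paths] count_other_red[OF \<open>k \<ge> 1\<close> \<open>n > k + 2\<close> paths]
      count_one_red[OF \<open>k \<ge> 1\<close> \<open>n > k + 2\<close> paths]
    by linarith
qed

end
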